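(* Let $f:\mathbb T^2\to\mathbb T^2$ be a non-wandering homeomorphism homotopic to the identity, and let $\widetilde f:\mathbb R^2\to\mathbb R^2$ be a lift of $f$ whose rotation set $\rho(\widetilde f)$ is the segment from $(0,0)$ to some totally irrational point $(\alpha,\beta)$. Then for any $\varepsilon>0$ there exists a lift $\widetilde g$ of a homeomorphism of $\mathbb T^2$ homotopic to the identity, with $\mathrm{dist}_{C^0}(\widetilde g,\widetilde f)<\varepsilon$, such that $\rho(\widetilde g)$ has non-empty interior and $$\rho(\widetilde f)\setminus\{(0,0)\}\subset \mathrm{Int}(\rho(\widetilde g)).$$
   Context: $\mathbb T^2=\mathbb R^2/\mathbb Z^2$ with projection $\pi:\mathbb R^2\to\mathbb T^2$. A homeomorphism $f$ is non-wandering if for every non-empty open set $U$ there is $n\ge1$ with $f^n(U)\cap U\neq\emptyset$. For a lift $\widetilde f$ of a homeomorphism of $\mathbb T^2$ homotopic to the identity, the (Misiurewicz–Ziemian) rotation set $\rho(\widetilde f)\subset\mathbb R^2$ is the set of all limits $\lim_{k\to\infty}\frac1{n_k}(\widetilde f^{n_k}(\widetilde z_k)-\widetilde z_k)$ with $n_k\to\infty$ and $\widetilde z_k\in\mathbb R^2$ (whenever the limit exists). A point $(\alpha,\beta)$ is totally irrational if $1,\alpha,\beta$ are linearly independent over $\mathbb Q$. $\mathrm{dist}_{C^0}(\widetilde g,\widetilde f)$ is the uniform distance between the lifts. *)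

theory Defs
  imports "HOL-Analysis.Analysis"
begin

type_synonym plane = "real \<times> real"

definition lattice_equiv :: "plane \<Rightarrow> plane \<Rightarrow> bool" where
  "lattice_equiv x y \<longleftrightarrow> x - y \<in> \<int> \<times> \<int>"

lemma equivp_lattice_equiv: "equivp lattice_equiv"
proof (rule equivpI)
  show "reflp lattice_equiv"
    by (auto simp: reflp_def lattice_equiv_def zero_prod_def)
  show "symp lattice_equiv"
  proof (rule sympI)
    fix x y assume "lattice_equiv x y"
    then show "lattice_equiv y x"
      using Ints_minus[of "fst x - fst y"] Ints_minus[of "snd x - snd y"]
      by (auto simp: lattice_equiv_def mem_Times_iff)
  qed
  show "transp lattice_equiv"
  proof (rule transpI)
    fix x y z assume "lattice_equiv x y" "lattice_equiv y z"
    then show "lattice_equiv x z"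
      using Ints_add[of "fst x - fst y" "fst y - fst z"]
        Ints_add[of "snd x - snd y" "snd y - snd z"]
      by (auto simp: lattice_equiv_def mem_Times_iff)
  qed
qed

quotient_type torus = plane / lattice_equiv
  by (rule equivp_lattice_equiv)

definition proj :: "plane \<Rightarrow> torus" where
  "proj = abs_torus"

instantiation torus :: topological_space
begin

definition open_torus :: "torus set \<Rightarrow> bool" where
  "open_torus U \<longleftrightarrow> open (proj -` U)"

instance
  by standard (auto simp: open_torus_def vimage_Union)

end

definition torus_homeomorphism :: "(torus \<Rightarrow> torus) \<Rightarrow> bool" where
  "torus_homeomorphism f \<longleftrightarrow> (\<exists>f'. homeomorphism UNIV UNIV f f')"

definition homotopic_to_id :: "(torus \<Rightarrow> torus) \<Rightarrow> bool" where
  "homotopic_to_id f \<longleftrightarrow> homotopic_with_canon (\<lambda>_. True) UNIV UNIV f id"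

definition non_wandering :: "(torus \<Rightarrow> torus) \<Rightarrow> bool" where
  "non_wandering f \<longleftrightarrow>
     (\<forall>U. open U \<and> U \<noteq> {} \<longrightarrow> (\<exists>n\<ge>1. (f ^^ n) ` U \<inter> U \<noteq> {}))"

definition is_lift :: "(plane \<Rightarrow> plane) \<Rightarrow> (torus \<Rightarrow> torus) \<Rightarrow> bool" where
  "is_lift F f \<longleftrightarrow> continuous_on UNIV F \<and> proj \<circ> F = f \<circ> proj"

definition rotation_set :: "(plane \<Rightarrow> plane) \<Rightarrow> plane set" where
  "rotation_set F =
     {v. \<exists>(n :: nat \<Rightarrow> nat) (z :: nat \<Rightarrow> plane).
           filterlim n at_top sequentially \<and>
           (\<lambda>k. (1 / real (n k)) *\<^sub>R ((F ^^ n k) (z k) - z k)) \<longlonglongrightarrow> v}"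

text \<open>
  Linear independence over the rationals is that of the family \<open>1, \<alpha>, \<beta>\<close>,
  so it excludes coincidences such as \<open>\<alpha> = \<beta>\<close>.
\<close>

definition totally_irrational :: "plane \<Rightarrow> bool" where
  "totally_irrational v \<longleftrightarrow>
     (\<forall>a\<in>\<rat>. \<forall>b\<in>\<rat>. \<forall>c\<in>\<rat>. a * 1 + b * fst v + c * snd v = 0 \<longrightarrow> a = 0 \<and> b = 0 \<and> c = 0)"

text \<open>
  Values are extended reals, so that the supremum is meaningful (namely infinite) for
  arbitrary maps at unbounded distance.
\<close>

definition dist_C0 :: "(plane \<Rightarrow> plane) \<Rightarrow> (plane \<Rightarrow> plane) \<Rightarrow> ereal" where
  "dist_C0 G F = (SUP z. ereal (dist (G z) (F z)))"

end

theory Submission imports Defs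
begin

text \<open>
  Call a finite walk \<open>c 0, \<dots>, c m = c 0 + w\<close> with \<open>w\<close> integral and every \<open>c (j + 1)\<close> within \<open>\<delta>\<close> of
  \<open>F (c j)\<close> a pseudo-loop, and \<open>w / m\<close> its rotation vector. Rotation vectors of pseudo-loops are
  rational, and this is what makes the theorem true: they cannot approximate a totally irrational
  vector from one side only.

  In detail, \<open>F\<close> commutes with integer translations, because it lifts a map homotopic to the identity
  (\<open>equivariant_lift_of_homotopic_to_id\<close>). Round the orbits of \<open>F\<close> to a fine grid. Modulo \<open>\<int>\<^sup>2\<close> the grid
  is finite, so a long rounded orbit is a sequence of short pseudo-loops plus a bounded remainder. Only
  finitely many rotation vectors \<open>T\<close> of short pseudo-loops occur, hence the whole rotation set of \<open>F\<close>
  lies in the polygon \<open>conv T\<close> (\<open>rotation_set_subset_hull_loop_vectors\<close>). The vertices of this polygon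
  are rational. The point \<open>(\<alpha>, \<beta>)\<close> lies on no rational line, so it is neither on an edge of the
  polygon nor is the polygon degenerate: it is an interior point (\<open>totally_irrational_in_interior\<close>).
  As the origin belongs to the polygon too, the half-open segment from it to \<open>(\<alpha>, \<beta>)\<close> is interior.

  It remains to find \<open>G\<close> close to \<open>F\<close> whose rotation set contains \<open>conv T\<close>. After a small
  displacement the points of all pseudo-loops are in general position. Then one horizontal shear
  followed by one vertical shear, both periodic and small, carries every \<open>F (c j)\<close> to \<open>c (j + 1)\<close>.
  Composing \<open>F\<close> with the shears turns all pseudo-loops into genuine periodic orbits
  (\<open>realise_pseudo_loops\<close>), so the rotation set of \<open>G\<close> contains \<open>T\<close>. That it contains the convex hull
  is the argument of Misiurewicz and Ziemian: every chord of the image of the unit square under an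
  iterate of \<open>G\<close> stays within distance 2 of that image, since otherwise the image would contain an arch
  over a disc of radius 2, and an arch that wide meets one of its own integer translates
  (\<open>arch_meets_lattice_translate\<close>), against injectivity. The bound does not depend on the iterate, so it
  disappears when displacements are divided by time
  (\<open>periodic_vectors_hull_subset_rotation_set\<close>).
\<close>

section \<open>Equivariant maps of the plane and maps of the torus\<close>

abbreviation lattice :: "plane set" where "lattice \<equiv> \<int> \<times> \<int>"

definition equivariant :: "(plane \<Rightarrow> plane) \<Rightarrow> bool" where
  "equivariant F \<longleftrightarrow> (\<forall>z. \<forall>w\<in>lattice. F (z + w) = F z + w)"

lemma equivariantD: "equivariant F \<Longrightarrow> w \<in> lattice \<Longrightarrow> F (z + w) = F z + w"
  unfolding equivariant_def by blast

lemma lattice_minus: "w \<in> lattice \<Longrightarrow> - w \<in> lattice"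
  by (auto simp: mem_Times_iff)

lemma zero_in_lattice: "0 \<in> lattice"
  by (auto simp: mem_Times_iff)

lemma lattice_scaleR_nat: "w \<in> lattice \<Longrightarrow> real k *\<^sub>R w \<in> lattice"
  by (auto simp: mem_Times_iff)

lemma equivariant_compose: "equivariant F \<Longrightarrow> equivariant G \<Longrightarrow> equivariant (F \<circ> G)"
  unfolding equivariant_def comp_def by metis

lemma equivariant_funpow: "equivariant G \<Longrightarrow> equivariant (G ^^ n)"
  by (induction n) (simp_all add: equivariant_def del: split_paired_All)

lemma obtain_lattice_translate:
  fixes z :: plane
  obtains w where "w \<in> lattice" "z + w \<in> {0..<1} \<times> {0..<1}"
proof
  show "(- of_int \<lfloor>fst z\<rfloor>, - of_int \<lfloor>snd z\<rfloor>) \<in> lattice" by simp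
  show "z + (- of_int \<lfloor>fst z\<rfloor>, - of_int \<lfloor>snd z\<rfloor>) \<in> {0..<1} \<times> {0..<1}"
    by (simp add: mem_Times_iff) linarith
qed

lemma obtain_lattice_translate_near:
  fixes z y :: plane
  obtains w where "w \<in> lattice" "dist (z + w) y < 1"
proof -
  obtain w where w: "w \<in> lattice" "(z - y + (1/2, 1/2)) + w \<in> {0..<1} \<times> {0..<1}"
    by (rule obtain_lattice_translate)
  define d where "d = z + w - y"
  have "z - y + (1/2, 1/2) + w = d + (1/2, 1/2)" by (simp add: d_def)
  with w(2) have "0 \<le> fst d + 1/2" "fst d + 1/2 < 1" "0 \<le> snd d + 1/2" "snd d + 1/2 < 1"
    by (simp_all add: mem_Times_iff)
  then have "\<bar>fst d\<bar> \<le> 1/2" "\<bar>snd d\<bar> \<le> 1/2" by linarith+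
  then have "(fst d)\<^sup>2 \<le> (1/2)\<^sup>2" "(snd d)\<^sup>2 \<le> (1/2)\<^sup>2" by (simp_all add: abs_le_square_iff[symmetric])
  then have "(norm d)\<^sup>2 < 1"
    by (simp add: norm_prod_def power2_eq_square)
  then have "norm d < 1" using power_less_imp_less_base[of "norm d" 2 1] by simp
  then show thesis using that[OF w(1)] by (simp add: dist_norm d_def)
qed

lemma proj_eq_iff: "proj x = proj y \<longleftrightarrow> x - y \<in> lattice"
  unfolding proj_def torus.abs_eq_iff lattice_equiv_def ..

lemma proj_rep_torus [simp]: "proj (rep_torus p) = p"
  unfolding proj_def by (rule Quotient_abs_rep[OF Quotient_torus])

lemma proj_add_lattice: "w \<in> lattice \<Longrightarrow> proj (z + w) = proj z"
  by (simp add: proj_eq_iff)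

lemma continuous_on_proj: "continuous_on A proj"
proof -
  have "continuous_on UNIV proj"
    by (subst continuous_on_open_vimage) (auto simp: open_torus_def)
  then show ?thesis by (rule continuous_on_subset) simp
qed

lemma open_proj_image:
  assumes "open U" shows "open (proj ` U)"
proof -
  have "proj -` (proj ` U) = (\<Union>w\<in>lattice. (+) w ` U)"
  proof (intro equalityI subsetI)
    fix x assume "x \<in> proj -` (proj ` U)"
    then obtain u where u: "u \<in> U" "x - u \<in> lattice" by (auto simp: proj_eq_iff)
    show "x \<in> (\<Union>w\<in>lattice. (+) w ` U)"
      using u by (intro UN_I[of "x - u"] image_eqI[of _ _ u]) simp_all
  next
    fix x assume "x \<in> (\<Union>w\<in>lattice. (+) w ` U)"
    then show "x \<in> proj -` (proj ` U)" by (force simp: proj_eq_iff)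
  qed
  then show ?thesis unfolding open_torus_def using assms by (auto intro: open_translation)
qed

text \<open>
  The topology of the torus is the quotient topology, so continuity is tested on the plane.
\<close>

lemma continuous_on_torus_via_lift:
  assumes "continuous_on UNIV (\<lambda>z. g (proj z))"
  shows "continuous_on UNIV (g :: torus \<Rightarrow> 'a::topological_space)"
proof (subst continuous_on_open_vimage, simp, intro allI impI)
  fix B :: "'a set" assume "open B"
  with assms have "open ((\<lambda>z. g (proj z)) -` B)"
    using continuous_on_open_vimage[of UNIV "\<lambda>z. g (proj z)"] by simp
  then show "open (g -` B \<inter> UNIV)" by (simp add: open_torus_def vimage_def)
qed

definition descend :: "(plane \<Rightarrow> plane) \<Rightarrow> torus \<Rightarrow> torus" where
  "descend G p = proj (G (rep_torus p))"

lemma descend_proj: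
  assumes "equivariant G" shows "descend G (proj z) = proj (G z)"
proof -
  have "rep_torus (proj z) - z \<in> lattice"
    by (simp flip: proj_eq_iff)
  from equivariantD[OF assms this, of z] have "G (rep_torus (proj z)) = G z + (rep_torus (proj z) - z)"
    by simp
  then show ?thesis unfolding descend_def proj_eq_iff
    using \<open>rep_torus (proj z) - z \<in> lattice\<close> by simp
qed

lemma continuous_on_descend:
  assumes "equivariant G" "continuous_on UNIV G"
  shows "continuous_on UNIV (descend G)"
  by (rule continuous_on_torus_via_lift)
    (auto simp: descend_proj[OF assms(1)] intro!: continuous_on_compose2[OF continuous_on_proj assms(2)])

lemma torus_homeomorphism_descend:
  assumes G: "equivariant G" "continuous_on UNIV G"
    and H: "equivariant H" "continuous_on UNIV H"
    and inv: "\<And>z. H (G z) = z" "\<And>z. G (H z) = z"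
  shows "torus_homeomorphism (descend G)"
proof -
  have "descend H (descend G p) = p" "descend G (descend H p) = p" for p
    using descend_proj[OF G(1)] descend_proj[OF H(1)] inv by (metis descend_def proj_rep_torus)+
  then have "homeomorphism UNIV UNIV (descend G) (descend H)"
    unfolding homeomorphism_def
    using continuous_on_descend[OF G] continuous_on_descend[OF H] by (metis UNIV_I surjI)
  then show ?thesis unfolding torus_homeomorphism_def by blast
qed

lemma torus_homeomorphism_compose:
  assumes "torus_homeomorphism f" "torus_homeomorphism g"
  shows "torus_homeomorphism (g \<circ> f)"
  using assms unfolding torus_homeomorphism_def by (blast intro: homeomorphism_compose)

text \<open>
  The straight-line homotopy between an equivariant map and the identity consists of equivariant maps,
  hence descends. Its continuity on the torus holds because \<open>proj\<close> is open, so that its product with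
  the identity of the interval is still a quotient map.
\<close>

lemma homotopic_to_id_of_equivariant_lift:
  assumes G: "equivariant G" "is_lift G g"
  shows "homotopic_to_id g"
proof -
  define h :: "real \<times> torus \<Rightarrow> torus" where
    "h = (\<lambda>(t, p). proj ((1 - t) *\<^sub>R G (rep_torus p) + t *\<^sub>R rep_torus p))"
  define h' :: "real \<times> plane \<Rightarrow> torus" where
    "h' = (\<lambda>(t, z). proj ((1 - t) *\<^sub>R G z + t *\<^sub>R z))"
  have hp: "h (t, proj z) = h' (t, z)" for t z
  proof -
    define w where "w = rep_torus (proj z) - z"
    have w: "w \<in> lattice" unfolding w_def by (simp flip: proj_eq_iff)
    have "rep_torus (proj z) = z + w" by (simp add: w_def)
    moreover have "G (z + w) = G z + w" using equivariantD[OF G(1) w] .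
    ultimately have "h (t, proj z) = proj ((1 - t) *\<^sub>R G z + t *\<^sub>R z + w)"
      by (simp add: h_def algebra_simps)
    then show ?thesis by (simp add: h'_def proj_add_lattice w)
  qed
  have contG: "continuous_on UNIV G" and lift: "proj (G z) = g (proj z)" for z
    using G(2) unfolding is_lift_def by (simp_all add: fun_eq_iff del: split_paired_All)
  have conth': "continuous_on UNIV h'"
    unfolding h'_def case_prod_beta
    by (intro continuous_on_compose2[OF continuous_on_proj] continuous_intros
        continuous_on_compose2[OF contG]) auto
  have conth: "continuous_on UNIV h"
  proof (subst continuous_on_open_vimage, simp, intro allI impI)
    fix B :: "torus set" assume "open B"
    then have o: "open (h' -` B)"
      using conth' continuous_on_open_vimage[of UNIV h'] by simp
    have "open (h -` B)"
    proof (subst open_subopen, rule ballI)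
      fix x assume x: "x \<in> h -` B"
      obtain t z where tz: "x = (t, proj z)" by (metis proj_rep_torus surj_pair)
      then have "(t, z) \<in> h' -` B" using x hp by simp
      from open_prod_elim[OF o this]
      obtain U V where UV: "open U" "open V" "(t, z) \<in> U \<times> V" "U \<times> V \<subseteq> h' -` B" by metis
      have "U \<times> (proj ` V) \<subseteq> h -` B" using UV(4) hp by auto
      moreover have "open (U \<times> (proj ` V))" using UV by (intro open_Times open_proj_image)
      moreover have "x \<in> U \<times> (proj ` V)" using UV tz by auto
      ultimately show "\<exists>T. open T \<and> x \<in> T \<and> T \<subseteq> h -` B" by blast
    qed
    then show "open (h -` B \<inter> UNIV)" by simp
  qed
  have h0: "h (0, p) = g p" for p
    using lift[of "rep_torus p"] by (simp add: h_def)
  have h1: "h (1, p) = p" for p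
    by (simp add: h_def)
  have "continuous_on ({0..1} \<times> UNIV) h" by (rule continuous_on_subset[OF conth]) simp
  then have "continuous_map (prod_topology (top_of_set {0..1}) (top_of_set UNIV)) (top_of_set UNIV) h"
    by (simp add: prod_topology_subtopology euclidean_product_topology)
  then show ?thesis
    unfolding homotopic_to_id_def homotopic_with_def
    using h0 h1 by (intro exI[of _ h]) auto
qed

section \<open>Lifts of maps homotopic to the identity\<close>

lemma exp_eq_one_imp_constant:
  fixes g :: "'a::topological_space \<Rightarrow> complex"
  assumes S: "connected S" "continuous_on S g" and one: "\<And>x. x \<in> S \<Longrightarrow> exp (g x) = 1"
    and xy: "x \<in> S" "y \<in> S"
  shows "g x = g y"
proof -
  have "g constant_on S"
  proof (rule continuous_discrete_range_constant[OF S])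
    fix a assume a: "a \<in> S"
    have "2 * pi \<le> norm (g b - g a)" if b: "b \<in> S" "g b \<noteq> g a" for b
    proof -
      obtain m n :: int where mn: "g a = complex_of_real (of_int (2 * m) * pi) * \<i>"
          "g b = complex_of_real (of_int (2 * n) * pi) * \<i>"
        using one[OF a] one[OF b(1)] unfolding exp_eq_1 by (auto simp: complex_eq_iff)
      then have "g b - g a = complex_of_real (2 * pi * of_int (n - m)) * \<i>"
        by (simp add: algebra_simps)
      then have "norm (g b - g a) = 2 * pi * \<bar>of_int (n - m)\<bar>"
        by (simp add: norm_mult abs_mult del: of_int_diff)
      moreover have "1 \<le> \<bar>n - m\<bar>" using mn b(2) by auto
      then have "1 \<le> \<bar>real_of_int (n - m)\<bar>" by linarith
      ultimately show ?thesis using mult_left_mono[of 1 "\<bar>real_of_int (n - m)\<bar>" "2 * pi"] by simp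
    qed
    then show "\<exists>e>0. \<forall>b. b \<in> S \<and> g b \<noteq> g a \<longrightarrow> e \<le> norm (g b - g a)"
      by (intro exI[of _ "2 * pi"]) auto
  qed
  then show ?thesis using xy unfolding constant_on_def by metis
qed

text \<open>
  The closed curve \<open>t \<mapsto> proj (z + t w)\<close> is moved by the homotopy from \<open>f\<close> to the identity. For an integral
  functional \<open>c\<close>, the map \<open>exp (2 \<pi> i c)\<close> from the torus to the circle assigns a winding number to each of
  the curves, and a logarithm on the square shows that it is the same at both ends of the
  homotopy: \<open>c (F (z + w)) - c (F z)\<close> at \<open>f\<close> and \<open>c w\<close> at the identity.
\<close>

lemma equivariant_coordinate:
  fixes c :: "plane \<Rightarrow> real"
  assumes h: "homotopic_to_id f" and F: "is_lift F f" and w: "w \<in> lattice"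
    and c: "bounded_linear c" and int: "\<And>v. v \<in> lattice \<Longrightarrow> c v \<in> \<int>"
  shows "c (F (z + w)) = c (F z + w)"
proof -
  define \<phi> :: "torus \<Rightarrow> complex" where "\<phi> p = exp (2 * pi * \<i> * c (rep_torus p))" for p
  have c_add: "c (x + y) = c x + c y" for x y
    using linear_add[OF bounded_linear.linear[OF c]] .
  have chi: "\<phi> (proj z) = exp (2 * pi * \<i> * c z)" for z
  proof -
    have "rep_torus (proj z) - z \<in> lattice" by (simp flip: proj_eq_iff)
    from int[OF this] obtain n :: int where n: "c (rep_torus (proj z) - z) = of_int n"
      by (auto elim: Ints_cases)
    have "c (rep_torus (proj z)) = c z + n"
      using c_add[of z "rep_torus (proj z) - z"] n by simp
    then show ?thesis unfolding \<phi>_def exp_eq by (intro exI[of _ n]) (simp add: algebra_simps)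
  qed
  have contc: "continuous_on A c" for A using c by (rule linear_continuous_on)
  have chi_cont: "continuous_on UNIV \<phi>"
    by (rule continuous_on_torus_via_lift) (auto simp: chi intro!: continuous_intros contc)
  from h obtain h where h: "continuous_on ({0..1::real} \<times> UNIV) h" "\<And>p. h (0, p) = f p" "\<And>p. h (1, p) = p"
    unfolding homotopic_to_id_def homotopic_with_def
    by (auto simp: prod_topology_subtopology euclidean_product_topology)
  have contF: "continuous_on A F" for A
    using F unfolding is_lift_def by (auto intro: continuous_on_subset)
  have lift: "proj (F z) = f (proj z)" for z
    using F unfolding is_lift_def by (simp_all add: fun_eq_iff del: split_paired_All)
  define K where "K = (\<lambda>(s, t). \<phi> (h (s, proj (z + t *\<^sub>R w))))"
  let ?I = "{0..1::real}"
  have "continuous_on (?I \<times> ?I) K"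
    unfolding K_def case_prod_beta
    by (intro continuous_on_compose2[OF chi_cont] continuous_on_compose2[OF h(1)] continuous_intros
        continuous_on_compose2[OF continuous_on_proj[of UNIV]]) auto
  moreover have "contractible (?I \<times> ?I)"
    by (intro convex_imp_contractible convex_Times) auto
  moreover have "K x \<noteq> 0" for x
    by (cases x) (simp add: K_def \<phi>_def)
  ultimately obtain L where L: "continuous_on (?I \<times> ?I) L" "\<And>x. x \<in> ?I \<times> ?I \<Longrightarrow> K x = exp (L x)"
    using continuous_logarithm_on_contractible by metis
  have Lc: "continuous_on ?I (\<lambda>s. L (a s, b s))" if "continuous_on ?I a" "continuous_on ?I b"
      "a ` ?I \<subseteq> ?I" "b ` ?I \<subseteq> ?I" for a b
    by (rule continuous_on_compose2[OF L(1)]) (use that in \<open>auto intro!: continuous_intros\<close>)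
  have K0: "K (0, t) = exp (2 * pi * \<i> * c (F (z + t *\<^sub>R w)))" for t
    by (simp add: K_def h chi flip: lift)
  have K1: "K (1, t) = exp (2 * pi * \<i> * c (z + t *\<^sub>R w))" for t
    by (simp add: K_def h chi)
  \<comment> \<open>The winding number, as the increment of the logarithm, is constant along the homotopy.\<close>
  have e1: "L (0, 1) - L (0, 0) = L (1, 1) - L (1, 0)"
  proof (rule exp_eq_one_imp_constant[of ?I "\<lambda>s. L (s, 1) - L (s, 0)"])
    show "continuous_on ?I (\<lambda>s. L (s, 1) - L (s, 0))"
      by (intro continuous_intros Lc) auto
    show "exp (L (s, 1) - L (s, 0)) = 1" if "s \<in> ?I" for s
    proof -
      have "K (s, 1) = K (s, 0)" unfolding K_def by (simp add: proj_add_lattice w)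
      then show ?thesis using that L(2)[of "(s, 1)"] L(2)[of "(s, 0)"] by (simp add: exp_diff)
    qed
  qed auto
  have e2: "L (0, 1) - 2 * pi * \<i> * c (F (z + 1 *\<^sub>R w)) = L (0, 0) - 2 * pi * \<i> * c (F (z + 0 *\<^sub>R w))"
  proof (rule exp_eq_one_imp_constant[of ?I "\<lambda>t. L (0, t) - 2 * pi * \<i> * c (F (z + t *\<^sub>R w))"])
    show "continuous_on ?I (\<lambda>t. L (0, t) - 2 * pi * \<i> * c (F (z + t *\<^sub>R w)))"
      by (intro continuous_intros Lc continuous_on_compose2[OF contc[of UNIV]]
          continuous_on_compose2[OF contF[of UNIV]]) auto
    show "exp (L (0, t) - 2 * pi * \<i> * c (F (z + t *\<^sub>R w))) = 1" if "t \<in> ?I" for t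
      using that L(2)[of "(0, t)"] K0[of t] by (simp add: exp_diff)
  qed auto
  have e3: "L (1, 1) - 2 * pi * \<i> * c (z + 1 *\<^sub>R w) = L (1, 0) - 2 * pi * \<i> * c (z + 0 *\<^sub>R w)"
  proof (rule exp_eq_one_imp_constant[of ?I "\<lambda>t. L (1, t) - 2 * pi * \<i> * c (z + t *\<^sub>R w)"])
    show "continuous_on ?I (\<lambda>t. L (1, t) - 2 * pi * \<i> * c (z + t *\<^sub>R w))"
      by (intro continuous_intros Lc continuous_on_compose2[OF contc[of UNIV]]) auto
    show "exp (L (1, t) - 2 * pi * \<i> * c (z + t *\<^sub>R w)) = 1" if "t \<in> ?I" for t
      using that L(2)[of "(1, t)"] K1[of t] by (simp add: exp_diff)
  qed auto
  have "x1 - x0 = y1 - y0"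
    if "a1 - a0 = b1 - b0" "a1 - x1 = a0 - x0" "b1 - y1 = b0 - y0" for a0 a1 b0 b1 x0 x1 y0 y1 :: complex
    using that by algebra
  from this[OF e1 e2 e3] have "2 * pi * \<i> * c (F (z + w)) - 2 * pi * \<i> * c (F z) = 2 * pi * \<i> * c (z + w) - 2 * pi * \<i> * c z"
    by simp
  then have "(2 * pi * \<i>) * complex_of_real (c (F (z + w)) - c (F z)) = (2 * pi * \<i>) * complex_of_real (c (z + w) - c z)"
    by (simp only: of_real_diff right_diff_distrib)
  then have "complex_of_real (c (F (z + w)) - c (F z)) = complex_of_real (c (z + w) - c z)"
    by (subst (asm) mult_cancel_left) simp
  then have "c (F (z + w)) - c (F z) = c (z + w) - c z"
    by (simp only: of_real_eq_iff)
  then show ?thesis by (simp add: c_add)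
qed

lemma equivariant_lift_of_homotopic_to_id:
  assumes "homotopic_to_id f" "is_lift F f"
  shows "equivariant F"
  unfolding equivariant_def
proof (intro allI ballI)
  fix z w assume w: "w \<in> lattice"
  show "F (z + w) = F z + w"
    using equivariant_coordinate[OF assms w bounded_linear_fst, of z]
      equivariant_coordinate[OF assms w bounded_linear_snd, of z]
    by (auto simp: prod_eq_iff mem_Times_iff)
qed

lemma inj_lift_of_torus_homeomorphism:
  assumes "torus_homeomorphism f" "is_lift F f" "equivariant F"
  shows "inj F"
proof (rule injI)
  fix x y assume eq: "F x = F y"
  have lift: "proj (F z) = f (proj z)" for z
    using assms(2) unfolding is_lift_def by (simp_all add: fun_eq_iff del: split_paired_All)
  have "inj f" using assms(1) unfolding torus_homeomorphism_def homeomorphism_def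
    by (metis UNIV_I injI)
  then have "x - y \<in> lattice" using eq lift by (metis injD proj_eq_iff)
  from equivariantD[OF assms(3) this, of y] show "x = y" using eq by simp
qed

section \<open>Walks along pseudo-orbits\<close>

lemma bounded_displacement:
  assumes "equivariant F" "continuous_on UNIV F"
  obtains C where "\<And>z. norm (F z - z) \<le> C"
proof -
  have "compact ((\<lambda>z. F z - z) ` ({0..1} \<times> {0..1}))"
    by (intro compact_continuous_image continuous_intros compact_Times continuous_on_subset[OF assms(2)]) auto
  then have "\<exists>C. \<forall>x\<in>(\<lambda>z. F z - z) ` ({0..1} \<times> {0..1}). norm x \<le> C"
    by (simp only: compact_imp_bounded flip: bounded_iff)
  then obtain C where C: "norm (F x - x) \<le> C" if "x \<in> {0..1} \<times> {0..1}" for x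
    by (meson imageI)
  show thesis
  proof (rule that)
    fix z :: plane
    obtain w where w: "w \<in> lattice" "z + w \<in> {0..<1} \<times> {0..<1}" by (rule obtain_lattice_translate)
    then have "z + w \<in> {0..1} \<times> {0..1}" by (auto simp: mem_Times_iff)
    then have "norm (F (z + w) - (z + w)) \<le> C" by (rule C)
    then show "norm (F z - z) \<le> C" using equivariantD[OF assms(1) w(1), of z] by simp
  qed
qed

text \<open>
  By equivariance it suffices to look at pairs of points within distance 1 of each other whose first
  member is in the unit square; these lie in one compact square.
\<close>

lemma equivariant_uniformly_continuous:
  assumes "equivariant F" "continuous_on UNIV F"
  shows "uniformly_continuous_on UNIV F"
proof -
  let ?K = "{-1..2::real} \<times> {-1..2::real}"
  have "uniformly_continuous_on ?K F"
    by (intro compact_uniformly_continuous compact_Times continuous_on_subset[OF assms(2)]) auto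
  then have uc: "\<exists>d>0. \<forall>x\<in>?K. \<forall>y\<in>?K. dist y x < d \<longrightarrow> dist (F y) (F x) < e" if "e > 0" for e
    using that unfolding uniformly_continuous_on_def by blast
  show ?thesis unfolding uniformly_continuous_on_def
  proof (intro allI impI)
    fix e :: real assume "e > 0"
    from uc[OF this] obtain d where d: "d > 0"
      "\<And>x y. x \<in> ?K \<Longrightarrow> y \<in> ?K \<Longrightarrow> dist y x < d \<Longrightarrow> dist (F y) (F x) < e" by metis
    have "dist (F y) (F x) < e" if xy: "dist y x < min d 1" for x y
    proof -
      obtain w where w: "w \<in> lattice" "x + w \<in> {0..<1} \<times> {0..<1}" by (rule obtain_lattice_translate)
      have eq: "dist (y + w) (x + w) = dist y x" by simp
      have "\<bar>fst (y + w) - fst (x + w)\<bar> \<le> dist y x" "\<bar>snd (y + w) - snd (x + w)\<bar> \<le> dist y x"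
        using dist_fst_le[of "y + w" "x + w"] dist_snd_le[of "y + w" "x + w"]
        unfolding eq by (simp_all add: dist_real_def)
      then have "\<bar>fst (y + w) - fst (x + w)\<bar> < 1" "\<bar>snd (y + w) - snd (x + w)\<bar> < 1"
        using xy by linarith+
      then have "x + w \<in> ?K" "y + w \<in> ?K" using w(2)
        by (simp_all add: mem_Times_iff) linarith+
      from d(2)[OF this] xy show ?thesis using equivariantD[OF assms(1) w(1)] by simp
    qed
    then show "\<exists>d>0. \<forall>x\<in>UNIV. \<forall>y\<in>UNIV. dist y x < d \<longrightarrow> dist (F y) (F x) < e"
      using d(1) by (intro exI[of _ "min d 1"]) auto
  qed
qed

definition pseudo_loop :: "(plane \<Rightarrow> plane) \<Rightarrow> real \<Rightarrow> nat \<Rightarrow> plane \<Rightarrow> (nat \<Rightarrow> plane) \<Rightarrow> bool" where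
  "pseudo_loop F \<delta> m w c \<longleftrightarrow> m \<ge> 1 \<and> w \<in> lattice \<and> c m = c 0 + w \<and>
     (\<forall>j<m. dist (F (c j)) (c (Suc j)) < \<delta>)"

definition loop_vectors :: "(plane \<Rightarrow> plane) \<Rightarrow> real \<Rightarrow> nat \<Rightarrow> plane set" where
  "loop_vectors F \<delta> M = {(1 / real m) *\<^sub>R w |m w. m \<le> M \<and> (\<exists>c. pseudo_loop F \<delta> m w c)}"

lemma walk_displacement:
  fixes c :: "nat \<Rightarrow> plane"
  assumes "\<And>j. j < n \<Longrightarrow> norm (c (Suc j) - c j) \<le> B"
  shows "norm (c n - c 0) \<le> real n * B"
  using assms
proof (induction n)
  case (Suc n)
  have "norm (c (Suc n) - c 0) \<le> norm (c (Suc n) - c n) + norm (c n - c 0)"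
    using norm_triangle_ineq[of "c (Suc n) - c n" "c n - c 0"] by simp
  also have "\<dots> \<le> B + real n * B" using Suc.IH Suc.prems by (intro add_mono) auto
  finally show ?case by (simp add: algebra_simps)
qed simp

lemma pseudo_step_bound:
  assumes "norm (F x - x) \<le> C" "dist (F x) y < \<delta>"
  shows "norm (y - x) \<le> C + \<delta>"
proof -
  have "norm (y - x) \<le> norm (y - F x) + norm (F x - x)"
    using norm_triangle_ineq[of "y - F x" "F x - x"] by simp
  then show ?thesis using assms by (simp add: dist_norm norm_minus_commute)
qed

lemma bounded_lattice_finite:
  "finite {w \<in> lattice. norm w \<le> R}"
proof -
  have "{w \<in> lattice. norm w \<le> R} \<subseteq> {x \<in> \<int>. \<bar>x\<bar> \<le> R} \<times> {x \<in> \<int>. \<bar>x\<bar> \<le> R}"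
  proof
    fix w assume w: "w \<in> {w \<in> lattice. norm w \<le> R}"
    have "\<bar>fst w\<bar> \<le> norm w" "\<bar>snd w\<bar> \<le> norm w"
      using norm_fst_le[of "fst w" "snd w"] norm_snd_le[of "snd w" "fst w"] by simp_all
    then show "w \<in> {x \<in> \<int>. \<bar>x\<bar> \<le> R} \<times> {x \<in> \<int>. \<bar>x\<bar> \<le> R}" using w by (auto simp: mem_Times_iff)
  qed
  then show ?thesis by (rule finite_subset) (intro finite_cartesian_product finite_abs_int_segment)
qed

lemma finite_loop_vectors:
  assumes C: "\<And>z. norm (F z - z) \<le> C"
  shows "finite (loop_vectors F \<delta> M)"
proof -
  have "loop_vectors F \<delta> M \<subseteq>
    (\<lambda>(m, w). (1 / real m) *\<^sub>R w) ` ({..M} \<times> {w \<in> lattice. norm w \<le> real M * \<bar>C + \<delta>\<bar>})"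
  proof
    fix t assume "t \<in> loop_vectors F \<delta> M"
    then obtain m w c where t: "t = (1 / real m) *\<^sub>R w" "m \<le> M" "pseudo_loop F \<delta> m w c"
      unfolding loop_vectors_def by blast
    then have l: "w \<in> lattice" "c m = c 0 + w" "\<And>j. j < m \<Longrightarrow> dist (F (c j)) (c (Suc j)) < \<delta>"
      unfolding pseudo_loop_def by auto
    have "norm (c m - c 0) \<le> real m * (C + \<delta>)"
      by (rule walk_displacement) (rule pseudo_step_bound[OF C l(3)])
    also have "\<dots> \<le> real m * \<bar>C + \<delta>\<bar>" by (intro mult_left_mono) auto
    also have "\<dots> \<le> real M * \<bar>C + \<delta>\<bar>" using t(2) by (intro mult_right_mono) auto
    finally have "norm w \<le> real M * \<bar>C + \<delta>\<bar>" using l(2) by simp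
    then show "t \<in> (\<lambda>(m, w). (1 / real m) *\<^sub>R w) ` ({..M} \<times> {w \<in> lattice. norm w \<le> real M * \<bar>C + \<delta>\<bar>})"
      using t l(1) by (intro image_eqI[of _ _ "(m, w)"]) auto
  qed
  then show ?thesis
    by (rule finite_subset) (intro finite_imageI finite_cartesian_product bounded_lattice_finite finite_atMost)
qed

text \<open>
  For convex \<open>S\<close> this is the set of sums of \<open>k\<close> elements of \<open>S\<close>. The empty sum belongs to it even
  if \<open>S\<close> is empty.
\<close>

definition scaled :: "nat \<Rightarrow> plane set \<Rightarrow> plane set" where
  "scaled k S = (if k = 0 then {0} else (*\<^sub>R) (real k) ` S)"

lemma scaled_add:
  assumes "convex S" "s \<in> scaled k S" "m \<ge> 1" "t \<in> S"
  shows "s + real m *\<^sub>R t \<in> scaled (k + m) S"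
proof (cases "k = 0")
  case True with assms show ?thesis by (auto simp: scaled_def)
next
  case False
  with assms obtain u where u: "u \<in> S" "s = real k *\<^sub>R u" by (auto simp: scaled_def)
  let ?v = "(real k / real (k + m)) *\<^sub>R u + (real m / real (k + m)) *\<^sub>R t"
  have "?v \<in> S" using False by (intro convexD[OF assms(1) u(1) assms(4)]) (auto simp flip: add_divide_distrib)
  moreover have "real (k + m) *\<^sub>R ?v = s + real m *\<^sub>R t"
    using False u by (simp add: scaleR_add_right del: of_nat_add)
  ultimately show ?thesis using False unfolding scaled_def by (metis add_is_0 image_eqI)
qed

text \<open>
  Loop erasure. Among the first \<open>M + 1\<close> points of a walk two agree modulo the lattice; the part between
  them is a pseudo-loop of length at most \<open>M\<close>. Cut it out, shift the rest of the walk back by its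
  translation vector, which is harmless because \<open>F\<close> is equivariant, and repeat until at most \<open>M\<close>
  steps are left. The number \<open>k\<close> counts the steps that were cut out.
\<close>

lemma walk_decomposition:
  fixes c :: "nat \<Rightarrow> plane"
  assumes F: "equivariant F" and C: "\<And>z. norm (F z - z) \<le> C" and C\<delta>: "C + \<delta> \<ge> 0"
    and repeat: "\<And>c :: nat \<Rightarrow> plane. (\<And>j. j \<le> M \<Longrightarrow> c j \<in> \<Gamma>) \<Longrightarrow> \<exists>i j. i < j \<and> j \<le> M \<and> c j - c i \<in> lattice"
    and trans: "\<And>z w. z \<in> \<Gamma> \<Longrightarrow> w \<in> lattice \<Longrightarrow> z - w \<in> \<Gamma>"
    and c: "\<And>j. j \<le> n \<Longrightarrow> c j \<in> \<Gamma>" "\<And>j. j < n \<Longrightarrow> dist (F (c j)) (c (Suc j)) < \<delta>"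
  shows "\<exists>k s. k \<le> n \<and> n \<le> k + M \<and> s \<in> scaled k (convex hull (loop_vectors F \<delta> M)) \<and>
           norm (c n - c 0 - s) \<le> real M * (C + \<delta>)"
  using c
proof (induction n arbitrary: c rule: less_induct)
  case (less n)
  show ?case
  proof (cases "n \<le> M")
    case True
    have "norm (c n - c 0) \<le> real n * (C + \<delta>)"
      by (rule walk_displacement) (rule pseudo_step_bound[OF C less.prems(2)])
    also have "\<dots> \<le> real M * (C + \<delta>)" using True C\<delta> by (intro mult_right_mono) auto
    finally show ?thesis using True by (intro exI[of _ 0]) (auto simp: scaled_def)
  next
    case False
    with less.prems(1) obtain i j where ij: "i < j" "j \<le> M" "c j - c i \<in> lattice"
      using repeat[of c] by auto
    define m w where "m = j - i" and "w = c j - c i"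
    \<comment> \<open>The walk with the steps from \<open>i\<close> to \<open>j\<close> removed.\<close>
    define c' where "c' l = (if l \<le> i then c l else c (l + m) - w)" for l
    have w: "w \<in> lattice" using ij(3) by (simp add: w_def)
    have m: "1 \<le> m" "m \<le> M" "m \<le> n" and im: "i + m = j" "i + m \<le> n" using ij False by (auto simp: m_def)
    have "pseudo_loop F \<delta> m w (\<lambda>l. c (i + l))"
      unfolding pseudo_loop_def using m w im less.prems(2) by (auto simp: w_def)
    then have t: "(1 / real m) *\<^sub>R w \<in> loop_vectors F \<delta> M"
      unfolding loop_vectors_def using m by blast
    have c'i: "c' l = c (l + m) - w" if "l \<ge> i" for l
      using that im by (cases "l = i") (auto simp: c'_def w_def)
    have Fw: "F (z - w) = F z - w" for z
      using equivariantD[OF F lattice_minus[OF w], of z] by simp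
    have "\<exists>k s. k \<le> n - m \<and> n - m \<le> k + M \<and> s \<in> scaled k (convex hull (loop_vectors F \<delta> M)) \<and>
           norm (c' (n - m) - c' 0 - s) \<le> real M * (C + \<delta>)"
    proof (rule less.IH)
      show "n - m < n" using m by simp
      show "c' l \<in> \<Gamma>" if "l \<le> n - m" for l
        using that less.prems(1) trans[OF _ w] m by (auto simp: c'_def)
      show "dist (F (c' l)) (c' (Suc l)) < \<delta>" if l: "l < n - m" for l
      proof (cases "l < i")
        case True then show ?thesis using less.prems(2)[of l] l by (simp add: c'_def)
      next
        case False
        then show ?thesis using less.prems(2)[of "l + m"] l c'i[of l] c'i[of "Suc l"]
          by (simp add: Fw dist_norm)
      qed
    qed
    then obtain k s where ks: "k \<le> n - m" "n - m \<le> k + M" "s \<in> scaled k (convex hull (loop_vectors F \<delta> M))"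
        "norm (c' (n - m) - c' 0 - s) \<le> real M * (C + \<delta>)" by blast
    have "s + real m *\<^sub>R ((1 / real m) *\<^sub>R w) \<in> scaled (k + m) (convex hull (loop_vectors F \<delta> M))"
      by (rule scaled_add[OF convex_convex_hull ks(3) m(1) hull_inc[OF t]])
    then have "s + w \<in> scaled (k + m) (convex hull (loop_vectors F \<delta> M))" using m by simp
    moreover
    have "c' (n - m) = c n - w" using c'i[of "n - m"] m im by simp
    then have "c' (n - m) - c' 0 - s = c n - c 0 - (s + w)" by (simp add: c'_def)
    with ks(4) have "norm (c n - c 0 - (s + w)) \<le> real M * (C + \<delta>)" by simp
    ultimately show ?thesis using ks(1,2) m by (intro exI[of _ "k + m"] exI[of _ "s + w"]) auto
  qed
qed

section \<open>The rotation set inside a rational polygon\<close>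

definition grid :: "nat \<Rightarrow> plane set" where
  "grid N = {z. real N * fst z \<in> \<int> \<and> real N * snd z \<in> \<int>}"

lemma grid_diff_lattice:
  assumes "z \<in> grid N" "w \<in> lattice" shows "z - w \<in> grid N"
  using assms by (auto simp: grid_def mem_Times_iff right_diff_distrib)

lemma grid_approximation:
  assumes "N \<ge> 1"
  obtains y where "y \<in> grid N" "dist y z \<le> 1 / real N"
proof
  let ?y = "(of_int (round (real N * fst z)) / real N, of_int (round (real N * snd z)) / real N)"
  show "?y \<in> grid N" using assms by (simp add: grid_def)
  have *: "\<bar>of_int (round (real N * x)) / real N - x\<bar> \<le> 1 / 2 / real N" for x
  proof -
    have "of_int (round (real N * x)) / real N - x = (of_int (round (real N * x)) - real N * x) / real N"
      using assms by (simp add: field_simps)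
    then show ?thesis
      using divide_right_mono[OF of_int_round_abs_le[of "real N * x"], of "real N"]
      by (simp add: abs_divide)
  qed
  have "dist ?y z \<le> \<bar>fst (?y - z)\<bar> + \<bar>snd (?y - z)\<bar>"
    unfolding dist_norm using norm_Pair_le[of "fst (?y - z)" "snd (?y - z)"] by (simp only: prod.collapse real_norm_def)
  also have "\<dots> \<le> 1 / 2 / real N + 1 / 2 / real N" using *[of "fst z"] *[of "snd z"] by simp
  also have "\<dots> = 1 / real N" by simp
  finally show "dist ?y z \<le> 1 / real N" .
qed

text \<open>
  The grid of mesh \<open>1 / N\<close> has \<open>N * N\<close> points modulo the lattice.
\<close>

lemma grid_repeat:
  fixes c :: "nat \<Rightarrow> plane"
  assumes N: "N \<ge> 1" and c: "\<And>j. j \<le> N * N \<Longrightarrow> c j \<in> grid N"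
  shows "\<exists>i j. i < j \<and> j \<le> N * N \<and> c j - c i \<in> lattice"
proof -
  define r where "r j = (\<lfloor>real N * fst (c j)\<rfloor> mod int N, \<lfloor>real N * snd (c j)\<rfloor> mod int N)" for j
  have "r ` {..N * N} \<subseteq> {0..<int N} \<times> {0..<int N}" using N by (auto simp: r_def)
  then have "card (r ` {..N * N}) \<le> card ({0..<int N} \<times> {0..<int N})" by (intro card_mono) auto
  then have "card (r ` {..N * N}) < card {..N * N}" by (simp add: card_cartesian_product)
  then have "\<not> inj_on r {..N * N}" by (rule pigeonhole)
  then obtain i j where ij: "i \<le> N * N" "j \<le> N * N" "i < j" "r i = r j"
    unfolding inj_on_def by (metis atMost_iff linorder_neqE_nat)
  have *: "y - x \<in> \<int>" if "real N * x \<in> \<int>" "real N * y \<in> \<int>"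
    "\<lfloor>real N * x\<rfloor> mod int N = \<lfloor>real N * y\<rfloor> mod int N" for x y :: real
  proof -
    have "int N dvd \<lfloor>real N * y\<rfloor> - \<lfloor>real N * x\<rfloor>" using that(3) by (metis mod_eq_dvd_iff)
    then obtain q where "\<lfloor>real N * y\<rfloor> - \<lfloor>real N * x\<rfloor> = int N * q" by (rule dvdE)
    then have "real_of_int \<lfloor>real N * y\<rfloor> - of_int \<lfloor>real N * x\<rfloor> = real N * of_int q"
      by (metis of_int_diff of_int_mult of_int_of_nat_eq)
    then have "real N * (y - x) = real N * of_int q"
      using that(1,2) by (simp add: of_int_floor_cancel[THEN iffD2] right_diff_distrib)
    then show ?thesis using N by simp
  qed
  have "c i \<in> grid N" "c j \<in> grid N" using c ij by auto
  with ij(4) have "fst (c j) - fst (c i) \<in> \<int>" "snd (c j) - snd (c i) \<in> \<int>"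
    unfolding grid_def r_def by (auto intro!: *)
  then have "c j - c i \<in> lattice" by (simp add: mem_Times_iff)
  with ij(2,3) show ?thesis by (intro exI conjI)
qed

text \<open>
  If the mesh is fine enough for the uniform continuity of \<open>F\<close>, rounding an orbit to the grid gives a
  walk with errors below \<open>\<delta>\<close>, to which \<open>walk_decomposition\<close> applies. The displacement of \<open>n\<close> steps is then
  \<open>k u\<close> up to a bounded error, with \<open>u\<close> in the hull and \<open>n - k\<close> bounded, so that dividing by
  \<open>n\<close> and passing to the limit stays in the compact hull.
\<close>

lemma rotation_set_subset_hull_loop_vectors:
  assumes F: "equivariant F" "continuous_on UNIV F" and \<delta>: "\<delta> > 0"
  obtains M where "rotation_set F \<subseteq> convex hull (loop_vectors F \<delta> M)" "finite (loop_vectors F \<delta> M)"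
proof -
  obtain C where C: "\<And>z. norm (F z - z) \<le> C" using bounded_displacement[OF F] by metis
  have C0: "C \<ge> 0" using C[of 0] norm_ge_zero order_trans by blast
  obtain d where d: "d > 0" "\<And>x y. dist x y < d \<Longrightarrow> dist (F x) (F y) < \<delta> / 2"
    using equivariant_uniformly_continuous[OF F] \<delta> unfolding uniformly_continuous_on_def
    by (metis UNIV_I half_gt_zero)
  obtain N :: nat where N0: "N \<ge> 1" and "1 / real N < min d (\<delta> / 2)"
  proof -
    obtain N :: nat where "N \<noteq> 0" "inverse (real N) < min d (\<delta> / 2)"
      using real_arch_inverse[of "min d (\<delta> / 2)"] d(1) \<delta> by auto
    then show thesis by (intro that[of N]) (auto simp: inverse_eq_divide)
  qed
  then have N: "N \<ge> 1" "1 / real N < d" "1 / real N < \<delta> / 2" by auto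
  define M where "M = N * N"
  let ?T = "loop_vectors F \<delta> M"
  have fin: "finite ?T" by (rule finite_loop_vectors[OF C])
  define A where "A = real M * (C + \<delta>) + 2 / real N"
  have key: "\<exists>k s. k \<le> n \<and> n \<le> k + M \<and> s \<in> scaled k (convex hull ?T) \<and> norm ((F ^^ n) z - z - s) \<le> A" for n z
  proof -
    have "\<exists>y. y \<in> grid N \<and> dist y ((F ^^ j) z) \<le> 1 / real N" for j
      using grid_approximation[OF N(1)] by metis
    then obtain c where c: "c j \<in> grid N" "dist (c j) ((F ^^ j) z) \<le> 1 / real N" for j by metis
    have step: "dist (F (c j)) (c (Suc j)) < \<delta>" for j
    proof -
      have "dist (F (c j)) (F ((F ^^ j) z)) < \<delta> / 2" using c(2)[of j] N(2) by (intro d(2)) simp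
      moreover have "dist (c (Suc j)) (F ((F ^^ j) z)) < \<delta> / 2" using c(2)[of "Suc j"] N(3) by simp
      ultimately show ?thesis
        using dist_triangle2[of "F (c j)" "c (Suc j)" "F ((F ^^ j) z)"] by simp
    qed
    have "\<exists>k s. k \<le> n \<and> n \<le> k + M \<and> s \<in> scaled k (convex hull ?T) \<and>
        norm (c n - c 0 - s) \<le> real M * (C + \<delta>)"
    proof (rule walk_decomposition[OF F(1) C _ _ grid_diff_lattice])
      show "0 \<le> C + \<delta>" using C0 \<delta> by simp
      show "\<exists>i j. i < j \<and> j \<le> M \<and> b j - b i \<in> lattice" if "\<And>j. j \<le> M \<Longrightarrow> b j \<in> grid N" for b
        unfolding M_def by (rule grid_repeat[OF N(1)]) (rule that[unfolded M_def])
    qed (use c(1) step in auto)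
    then obtain k s where ks: "k \<le> n" "n \<le> k + M" "s \<in> scaled k (convex hull ?T)"
      "norm (c n - c 0 - s) \<le> real M * (C + \<delta>)" by blast
    have eq: "(F ^^ n) z - z - s = (c n - c 0 - s) + (((F ^^ n) z - c n) + (c 0 - z))" by simp
    have "norm ((F ^^ n) z - z - s) \<le> norm (c n - c 0 - s) + (norm ((F ^^ n) z - c n) + norm (c 0 - z))"
      unfolding eq by (intro order_trans[OF norm_triangle_ineq] add_left_mono norm_triangle_ineq)
    also have "\<dots> \<le> A" unfolding A_def
      using ks(4) c(2)[of n] c(2)[of 0] by (simp add: dist_norm norm_minus_commute)
    finally show ?thesis using ks by blast
  qed
  have "rotation_set F \<subseteq> convex hull ?T"
  proof
    fix v assume "v \<in> rotation_set F"
    then obtain n z where n: "filterlim n at_top sequentially"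
      and lim: "(\<lambda>k. (1 / real (n k)) *\<^sub>R ((F ^^ n k) (z k) - z k)) \<longlonglongrightarrow> v"
      unfolding rotation_set_def by blast
    have "compact (convex hull ?T)" using fin by (intro compact_convex_hull finite_imp_compact)
    then obtain R where R: "R > 0" "\<And>u. u \<in> convex hull ?T \<Longrightarrow> norm u \<le> R"
      using compact_imp_bounded bounded_pos by metis
    have cl: "closed (convex hull ?T)" using \<open>compact (convex hull ?T)\<close> by (rule compact_imp_closed)
    obtain k s where ks: "k i \<le> n i" "n i \<le> k i + M" "s i \<in> scaled (k i) (convex hull ?T)"
      "norm ((F ^^ n i) (z i) - z i - s i) \<le> A" for i
      using key[of "n i" "z i" for i] by metis
    have big: "\<forall>\<^sub>F i in sequentially. n i > M"
      using n[unfolded filterlim_at_top, rule_format, of "Suc M"] by (simp add: Suc_le_eq)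
    define u where "u i = (1 / real (k i)) *\<^sub>R s i" for i
    have u: "u i \<in> convex hull ?T \<and> s i = real (k i) *\<^sub>R u i" if "n i > M" for i
      using ks(2,3)[of i] that by (auto simp: scaled_def u_def split: if_splits)
    have "(\<lambda>i. (1 / real (n i)) *\<^sub>R ((F ^^ n i) (z i) - z i) - u i) \<longlonglongrightarrow> 0"
    proof (rule Lim_null_comparison)
      show "(\<lambda>i. (A + real M * R) * (1 / real (n i))) \<longlonglongrightarrow> 0"
        by (intro tendsto_mult_right_zero)
          (rule filterlim_compose[OF lim_1_over_n n])
      show "\<forall>\<^sub>F i in sequentially. norm ((1 / real (n i)) *\<^sub>R ((F ^^ n i) (z i) - z i) - u i)
         \<le> (A + real M * R) * (1 / real (n i))"
        using big
      proof eventually_elim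
        case (elim i)
        have ni: "real (n i) > 0" using elim by simp
        let ?D = "(F ^^ n i) (z i) - z i"
        have nk: "real (n i) - real (k i) \<ge> 0" "real (n i) - real (k i) \<le> real M"
          using ks(1,2)[of i] by linarith+
        have "?D - real (n i) *\<^sub>R u i = (?D - s i) - (real (n i) - real (k i)) *\<^sub>R u i"
          using u[OF elim] by (simp add: scaleR_left_diff_distrib)
        then have "norm (?D - real (n i) *\<^sub>R u i) \<le> norm (?D - s i) + norm ((real (n i) - real (k i)) *\<^sub>R u i)"
          by (metis norm_triangle_ineq4)
        also have "\<dots> \<le> A + real M * R"
          using ks(4)[of i] nk R(1) R(2)[of "u i"] u[OF elim] by (auto intro!: add_mono mult_mono)
        finally have *: "norm (?D - real (n i) *\<^sub>R u i) \<le> A + real M * R" .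
        have "(1 / real (n i)) *\<^sub>R ?D - u i = (1 / real (n i)) *\<^sub>R (?D - real (n i) *\<^sub>R u i)"
          using ni by (simp add: scaleR_right_diff_distrib)
        then have "norm ((1 / real (n i)) *\<^sub>R ?D - u i) = (1 / real (n i)) * norm (?D - real (n i) *\<^sub>R u i)"
          by simp
        also have "\<dots> \<le> (1 / real (n i)) * (A + real M * R)"
          using * ni by (intro mult_left_mono) auto
        finally show ?case by (simp add: mult.commute)
      qed
    qed
    from tendsto_diff[OF lim this] have "u \<longlonglongrightarrow> v" by simp
    moreover have "\<forall>\<^sub>F i in sequentially. u i \<in> convex hull ?T"
      using big by eventually_elim (use u in blast)
    ultimately show "v \<in> convex hull ?T"
      by (rule Lim_in_closed_set[OF cl, rotated -1]) auto
  qed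
  with fin that show thesis by blast
qed

lemma loop_vectors_rational: "loop_vectors F \<delta> M \<subseteq> \<rat> \<times> \<rat>"
  using Ints_subset_Rats
  by (auto simp: loop_vectors_def pseudo_loop_def intro!: Rats_divide simp flip: of_nat_Suc)

text \<open>
  Otherwise a line supports the hull at \<open>v\<close> (or contains the whole hull), and \<open>v\<close> is a convex
  combination of those points of \<open>T\<close> that lie on this line. Either there is only one of them, and \<open>v\<close>
  is rational, or two of them span the line, which then has a rational equation.
\<close>

lemma totally_irrational_in_interior:
  assumes v: "totally_irrational v" and T: "finite T" "T \<subseteq> \<rat> \<times> \<rat>" and vT: "v \<in> convex hull T"
  shows "v \<in> interior (convex hull T)"
proof (rule ccontr)
  assume nint: "v \<notin> interior (convex hull T)"
  have irr: "a = 0 \<and> b = 0 \<and> c = 0"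
    if "a \<in> \<rat>" "b \<in> \<rat>" "c \<in> \<rat>" "a + b * fst v + c * snd v = 0" for a b c
    using v that unfolding totally_irrational_def by auto
  have "\<exists>a. a \<noteq> 0 \<and> (\<forall>t\<in>convex hull T. a \<bullet> t \<le> a \<bullet> v)"
  proof (cases "interior (convex hull T) = {}")
    case True
    then obtain a b where "a \<noteq> 0" "convex hull T \<subseteq> {x. a \<bullet> x = b}"
      using empty_interior_subset_hyperplane[OF convex_convex_hull] by metis
    then have "a \<bullet> t = b" if "t \<in> convex hull T" for t using that by blast
    then show ?thesis using vT \<open>a \<noteq> 0\<close> by (metis order_refl)
  next
    case False
    have "\<exists>a b. a \<noteq> 0 \<and> (\<forall>x\<in>interior (convex hull T). a \<bullet> x \<le> b) \<and> (\<forall>x\<in>{v}. a \<bullet> x \<ge> b)"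
      using nint False by (intro separating_hyperplane_sets convex_interior) auto
    then obtain a b where ab: "a \<noteq> 0" "\<And>x. x \<in> interior (convex hull T) \<Longrightarrow> a \<bullet> x \<le> b" "a \<bullet> v \<ge> b" by auto
    have "closure (interior (convex hull T)) \<subseteq> {x. a \<bullet> x \<le> b}"
      using ab(2) by (intro closure_minimal closed_halfspace_le) auto
    moreover have "convex hull T \<subseteq> closure (interior (convex hull T))"
      using False closure_subset convex_closure_interior[of "convex hull T"] by auto
    ultimately show ?thesis using ab by (intro exI[of _ a]) force
  qed
  then obtain a where a: "a \<noteq> 0" "\<And>t. t \<in> T \<Longrightarrow> a \<bullet> t \<le> a \<bullet> v"
    by (metis hull_inc)
  obtain u where u: "\<And>t. t \<in> T \<Longrightarrow> 0 \<le> u t" "sum u T = 1" "(\<Sum>t\<in>T. u t *\<^sub>R t) = v"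
    using vT unfolding convex_hull_finite[OF T(1)] by auto
  \<comment> \<open>Points off the supporting line have weight zero.\<close>
  have "(\<Sum>t\<in>T. u t * (a \<bullet> v - a \<bullet> t)) = sum u T * (a \<bullet> v) - a \<bullet> (\<Sum>t\<in>T. u t *\<^sub>R t)"
    by (simp add: inner_sum_right sum_distrib_right right_diff_distrib sum_subtractf)
  then have "(\<Sum>t\<in>T. u t * (a \<bullet> v - a \<bullet> t)) = 0" using u by simp
  then have z: "u t * (a \<bullet> v - a \<bullet> t) = 0" if "t \<in> T" for t
    using sum_nonneg_eq_0_iff[OF T(1), of "\<lambda>t. u t * (a \<bullet> v - a \<bullet> t)"] u(1) a(2) that by auto
  obtain t0 where t0: "t0 \<in> T" "u t0 \<noteq> 0" using u(2) by (metis sum.neutral zero_neq_one)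
  show False
  proof (cases "\<forall>t\<in>T. u t \<noteq> 0 \<longrightarrow> t = t0")
    case True
    have "v = (\<Sum>t\<in>T. u t *\<^sub>R t0)" unfolding u(3)[symmetric] using True by (intro sum.cong) auto
    then have "v = t0" using u(2) by (simp flip: scaleR_left.sum)
    then show False using irr[of "- fst v" 1 0] T(2) t0 by (auto simp: mem_Times_iff)
  next
    case False
    then obtain t1 where t1: "t1 \<in> T" "u t1 \<noteq> 0" "t1 \<noteq> t0" by blast
    have o: "a \<bullet> (t1 - t0) = 0" "a \<bullet> (v - t0) = 0"
      using z[OF t0(1)] z[OF t1(1)] t0 t1 by (simp_all add: inner_diff_right)
    obtain a1 a2 where a12: "a = (a1, a2)" by force
    obtain p0 q0 p1 q1 x y where t: "t0 = (p0, q0)" "t1 = (p1, q1)" "v = (x, y)" by force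
    have rat: "p0 \<in> \<rat>" "q0 \<in> \<rat>" "p1 \<in> \<rat>" "q1 \<in> \<rat>" using T(2) t0 t1 t by auto
    have e: "a1 * (p1 - p0) + a2 * (q1 - q0) = 0" "a1 * (x - p0) + a2 * (y - q0) = 0"
      using o by (simp_all add: a12 t)
    \<comment> \<open>Two vectors orthogonal to \<open>a \<noteq> 0\<close> in the plane are parallel.\<close>
    have "a1 * ((p1 - p0) * (y - q0) - (q1 - q0) * (x - p0)) = 0"
      "a2 * ((p1 - p0) * (y - q0) - (q1 - q0) * (x - p0)) = 0"
      using e by algebra+
    moreover have "a1 \<noteq> 0 \<or> a2 \<noteq> 0" using a(1) a12 by (auto simp: zero_prod_def)
    ultimately have "(p1 - p0) * (y - q0) - (q1 - q0) * (x - p0) = 0" by auto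
    then have eq: "((q1 - q0) * p0 - (p1 - p0) * q0) + (q0 - q1) * fst v + (p1 - p0) * snd v = 0"
      by (simp add: t(3) algebra_simps)
    have "q0 - q1 = 0 \<and> p1 - p0 = 0"
      using irr[OF _ _ _ eq] rat by (simp add: Rats_diff Rats_mult)
    then show False using t t1(3) by simp
  qed
qed

section \<open>Realising pseudo-loops by two shears\<close>

lemma cos_eq_one_iff_Ints: "cos (2 * pi * x) = 1 \<longleftrightarrow> x \<in> \<int>"
proof
  assume "cos (2 * pi * x) = 1"
  then obtain n :: int where "2 * pi * x = of_int n * 2 * pi" unfolding cos_one_2pi_int by blast
  then have "x = of_int n" by simp
  then show "x \<in> \<int>" by simp
next
  assume "x \<in> \<int>" then show "cos (2 * pi * x) = 1" by (auto elim: Ints_cases)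
qed

text \<open>
  Trigonometric Lagrange interpolation: the factor \<open>1 - cos (2 \<pi> (x - q))\<close> has period 1 and vanishes
  exactly at the integer translates of \<open>q\<close>. Between the nodes the interpolant may be large, so it is
  truncated to the interval from \<open>- r\<close> to \<open>r\<close>, which contains the prescribed values.
\<close>

lemma periodic_interpolation:
  fixes q v :: "'i \<Rightarrow> real"
  assumes I: "finite I" and q: "\<And>i j. i \<in> I \<Longrightarrow> j \<in> I \<Longrightarrow> i \<noteq> j \<Longrightarrow> q i - q j \<notin> \<int>"
    and v: "\<And>i. i \<in> I \<Longrightarrow> \<bar>v i\<bar> \<le> r" and r: "r \<ge> 0"
  obtains \<phi> where "continuous_on UNIV \<phi>" "\<And>x n. n \<in> \<int> \<Longrightarrow> \<phi> (x + n) = \<phi> x"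
    "\<And>x. \<bar>\<phi> x\<bar> \<le> r" "\<And>i. i \<in> I \<Longrightarrow> \<phi> (q i) = v i"
proof -
  define b where "b x = 1 - cos (2 * pi * x)" for x :: real
  have b0: "b x = 0 \<longleftrightarrow> x \<in> \<int>" for x using cos_eq_one_iff_Ints[of x] by (auto simp: b_def)
  have bper: "b (x + n - y) = b (x - y)" if "n \<in> \<int>" for x y n
  proof -
    from that obtain k :: int where n: "n = of_int k" by (auto elim: Ints_cases)
    have "cos (2 * pi * (x - y) + 2 * pi * of_int k) = cos (2 * pi * (x - y))"
      by (simp add: cos_add)
    then show ?thesis by (simp add: b_def n algebra_simps)
  qed
  define B where "B i x = (\<Prod>j\<in>I - {i}. b (x - q j) / b (q i - q j))" for i x
  define \<phi>0 where "\<phi>0 x = (\<Sum>i\<in>I. v i * B i x)" for x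
  have val: "\<phi>0 (q i) = v i" if i: "i \<in> I" for i
  proof -
    have "B i (q i) = 1"
      unfolding B_def using q i by (intro prod.neutral) (auto simp: b0)
    moreover have "B j (q i) = 0" if "j \<in> I" "j \<noteq> i" for j
      unfolding B_def using that i I by (intro prod_zero) (auto intro!: bexI[of _ i] simp: b_def)
    ultimately have "\<phi>0 (q i) = (\<Sum>j\<in>I. if j = i then v i else 0)"
      unfolding \<phi>0_def by (intro sum.cong) auto
    then show ?thesis using i I by simp
  qed
  show thesis
  proof (rule that)
    let ?\<phi> = "\<lambda>x. max (- r) (min r (\<phi>0 x))"
    have "continuous_on UNIV (\<lambda>x. b (x - y))" for y
      unfolding b_def by (intro continuous_intros)
    then have Bc: "continuous_on UNIV (\<lambda>x. b (x - q j) / b (q i - q j))" if "i \<in> I" "j \<in> I - {i}" for i j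
      using q that by (intro continuous_on_divide continuous_on_const) (auto simp: b0)
    have "continuous_on UNIV (B i)" if "i \<in> I" for i
      unfolding B_def by (intro continuous_on_prod Bc that)
    then show "continuous_on UNIV ?\<phi>"
      unfolding \<phi>0_def by (intro continuous_intros) auto
    show "?\<phi> (x + n) = ?\<phi> x" if "n \<in> \<int>" for x n
      unfolding \<phi>0_def B_def by (simp add: bper[OF that])
    show "\<bar>?\<phi> x\<bar> \<le> r" for x using r by auto
    show "?\<phi> (q i) = v i" if "i \<in> I" for i using val[OF that] v[OF that] by auto
  qed
qed

definition hshear :: "(real \<Rightarrow> real) \<Rightarrow> plane \<Rightarrow> plane" where
  "hshear \<phi> z = (fst z + \<phi> (snd z), snd z)"

definition vshear :: "(real \<Rightarrow> real) \<Rightarrow> plane \<Rightarrow> plane" where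
  "vshear \<psi> z = (fst z, snd z + \<psi> (fst z))"

lemma hshear_equivariant: "(\<And>x n. n \<in> \<int> \<Longrightarrow> \<phi> (x + n) = \<phi> x) \<Longrightarrow> equivariant (hshear \<phi>)"
  by (auto simp: equivariant_def hshear_def)

lemma vshear_equivariant: "(\<And>x n. n \<in> \<int> \<Longrightarrow> \<phi> (x + n) = \<phi> x) \<Longrightarrow> equivariant (vshear \<phi>)"
  by (auto simp: equivariant_def vshear_def)

lemma hshear_continuous: "continuous_on UNIV \<phi> \<Longrightarrow> continuous_on UNIV (hshear \<phi>)"
  unfolding hshear_def
  by (intro continuous_on_Pair continuous_on_add continuous_on_fst continuous_on_snd continuous_on_id
      continuous_on_compose2[of UNIV \<phi> UNIV snd]) auto

lemma vshear_continuous: "continuous_on UNIV \<phi> \<Longrightarrow> continuous_on UNIV (vshear \<phi>)"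
  unfolding vshear_def
  by (intro continuous_on_Pair continuous_on_add continuous_on_fst continuous_on_snd continuous_on_id
      continuous_on_compose2[of UNIV \<phi> UNIV fst]) auto

text \<open>
  The horizontal shear first gives every point its final first coordinate; it needs the second
  coordinates of the sources to be distinct modulo 1. The vertical shear then corrects the second
  coordinate, and needs the first coordinates of the targets to be distinct modulo 1. Shears are
  homeomorphisms with explicit inverses, and crossing displacements cause no difficulty.
\<close>

lemma shear_matching:
  fixes a b :: "'i \<Rightarrow> plane"
  assumes I: "finite I" and r: "r \<ge> 0"
    and a: "\<And>i j. i \<in> I \<Longrightarrow> j \<in> I \<Longrightarrow> i \<noteq> j \<Longrightarrow> snd (a i) - snd (a j) \<notin> \<int>"
    and b: "\<And>i j. i \<in> I \<Longrightarrow> j \<in> I \<Longrightarrow> i \<noteq> j \<Longrightarrow> fst (b i) - fst (b j) \<notin> \<int>"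
    and ab: "\<And>i. i \<in> I \<Longrightarrow> dist (a i) (b i) \<le> r"
  obtains H K where "equivariant H" "continuous_on UNIV H" "equivariant K" "continuous_on UNIV K"
    "\<And>z. K (H z) = z" "\<And>z. H (K z) = z" "\<And>z. dist (H z) z \<le> 2 * r" "\<And>i. i \<in> I \<Longrightarrow> H (a i) = b i"
proof -
  have f: "\<bar>fst (b i) - fst (a i)\<bar> \<le> r" and s: "\<bar>snd (b i) - snd (a i)\<bar> \<le> r" if "i \<in> I" for i
    using dist_fst_le[of "a i" "b i"] dist_snd_le[of "a i" "b i"] ab[OF that] by (auto simp: dist_real_def)
  obtain \<phi> where \<phi>: "continuous_on UNIV \<phi>" "\<And>x n. n \<in> \<int> \<Longrightarrow> \<phi> (x + n) = \<phi> x" "\<And>x. \<bar>\<phi> x\<bar> \<le> r"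
      "\<And>i. i \<in> I \<Longrightarrow> \<phi> (snd (a i)) = fst (b i) - fst (a i)"
    using periodic_interpolation[where q = "\<lambda>i. snd (a i)" and v = "\<lambda>i. fst (b i) - fst (a i)", OF I a f r]
    by blast
  obtain \<psi> where \<psi>: "continuous_on UNIV \<psi>" "\<And>x n. n \<in> \<int> \<Longrightarrow> \<psi> (x + n) = \<psi> x" "\<And>x. \<bar>\<psi> x\<bar> \<le> r"
      "\<And>i. i \<in> I \<Longrightarrow> \<psi> (fst (b i)) = snd (b i) - snd (a i)"
    using periodic_interpolation[where q = "\<lambda>i. fst (b i)" and v = "\<lambda>i. snd (b i) - snd (a i)", OF I b s r]
    by blast
  let ?H = "vshear \<psi> \<circ> hshear \<phi>" and ?K = "hshear (\<lambda>x. - \<phi> x) \<circ> vshear (\<lambda>x. - \<psi> x)"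
  have c: "continuous_on UNIV (F \<circ> G)" if "continuous_on UNIV F" "continuous_on UNIV G" for F G :: "plane \<Rightarrow> plane"
    using that by (intro continuous_on_compose) (auto intro: continuous_on_subset)
  show thesis
  proof (rule that)
    show "equivariant ?H" "equivariant ?K"
      using \<phi>(2) \<psi>(2) by (auto intro!: equivariant_compose vshear_equivariant hshear_equivariant)
    show "continuous_on UNIV ?H"
      by (rule c[OF vshear_continuous[OF \<psi>(1)] hshear_continuous[OF \<phi>(1)]])
    show "continuous_on UNIV ?K"
      by (rule c[OF hshear_continuous vshear_continuous]) (intro continuous_intros \<phi>(1) \<psi>(1))+
    show "?K (?H z) = z" "?H (?K z) = z" for z by (simp_all add: hshear_def vshear_def)
    show "dist (?H z) z \<le> 2 * r" for z
    proof -
      have "dist (vshear \<psi> (hshear \<phi> z)) (hshear \<phi> z) \<le> r"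
        using \<psi>(3) by (simp add: dist_norm vshear_def hshear_def norm_Pair)
      moreover have "dist (hshear \<phi> z) z \<le> r"
        using \<phi>(3) by (cases z) (simp add: dist_norm hshear_def norm_Pair)
      ultimately show ?thesis using dist_triangle[of "?H z" z "hshear \<phi> z"] by simp
    qed
    show "?H (a i) = b i" if "i \<in> I" for i
      using \<phi>(4)[OF that] \<psi>(4)[OF that] by (simp add: hshear_def vshear_def prod_eq_iff)
  qed
qed

lemma open_avoids_integer_translates:
  fixes U :: "'a::topological_space set" and \<pi> :: "'a \<Rightarrow> real"
  assumes "open (\<pi> ` U)" "U \<noteq> {}" "finite J"
  obtains z where "z \<in> U" "\<And>j. j \<in> J \<Longrightarrow> \<pi> z - p j \<notin> \<int>"
proof -
  have "countable (\<Union>j\<in>J. (+) (p j) ` \<int>)"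
    using assms(3) by (intro countable_UN countable_image countable_int) (auto intro: countable_finite)
  from open_minus_countable[OF this _ assms(1)] assms(2)
  obtain z where z: "z \<in> U" "\<pi> z \<notin> (\<Union>j\<in>J. (+) (p j) ` \<int>)" by auto
  have "\<pi> z - p j \<notin> \<int>" if "j \<in> J" for j
  proof
    assume "\<pi> z - p j \<in> \<int>"
    then have "\<pi> z \<in> (+) (p j) ` \<int>" by (intro image_eqI[of _ _ "\<pi> z - p j"]) auto
    with z(2) that show False by blast
  qed
  with z(1) that show thesis by blast
qed

text \<open>
  The points are chosen one after the other. The condition on first coordinates excludes a closed set
  with empty interior from the ball around \<open>c i\<close>; what remains is open, and so is its image under \<open>F\<close>
  by invariance of domain. Hence \<open>F\<close> cannot map it into countably many horizontal lines.
\<close>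

lemma general_position:
  fixes c :: "'i \<Rightarrow> plane" and F :: "plane \<Rightarrow> plane"
  assumes F: "continuous_on UNIV F" "inj F" and I: "finite I" and \<eta>: "\<eta> > 0"
  obtains x where "\<And>i. i \<in> I \<Longrightarrow> dist (x i) (c i) < \<eta>"
    "\<And>i j. i \<in> I \<Longrightarrow> j \<in> I \<Longrightarrow> i \<noteq> j \<Longrightarrow> fst (x i) - fst (x j) \<notin> \<int>"
    "\<And>i j. i \<in> I \<Longrightarrow> j \<in> I \<Longrightarrow> i \<noteq> j \<Longrightarrow> snd (F (x i)) - snd (F (x j)) \<notin> \<int>"
proof -
  have "\<exists>x. (\<forall>i\<in>I. dist (x i) (c i) < \<eta>) \<and>
    (\<forall>i\<in>I. \<forall>j\<in>I. i \<noteq> j \<longrightarrow> fst (x i) - fst (x j) \<notin> \<int> \<and> snd (F (x i)) - snd (F (x j)) \<notin> \<int>)"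
    using I
  proof (induction I)
    case (insert k I)
    from insert.IH obtain x where x: "\<forall>i\<in>I. dist (x i) (c i) < \<eta>"
      "\<forall>i\<in>I. \<forall>j\<in>I. i \<noteq> j \<longrightarrow> fst (x i) - fst (x j) \<notin> \<int> \<and> snd (F (x i)) - snd (F (x j)) \<notin> \<int>" by (elim exE conjE)
    define U where "U = ball (c k) \<eta> - (\<Union>j\<in>I. (\<lambda>z. fst z - fst (x j)) -` \<int>)"
    have "closed ((\<lambda>z::plane. fst z - fst (x j)) -` \<int>)" for j
      by (intro continuous_closed_vimage closed_Ints continuous_diff continuous_fst continuous_ident continuous_const)
    then have "open U" unfolding U_def using insert.hyps(1) by (intro open_Diff open_ball closed_UN) auto
    have "open (fst ` ball (c k) \<eta>)" by (intro open_image_fst open_ball)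
    moreover have "ball (c k) \<eta> \<noteq> {}" using \<eta> by simp
    ultimately obtain z0 where "z0 \<in> ball (c k) \<eta>" "\<And>j. j \<in> I \<Longrightarrow> fst z0 - fst (x j) \<notin> \<int>"
      using open_avoids_integer_translates[of fst "ball (c k) \<eta>" I "\<lambda>j. fst (x j)"] insert.hyps(1) by blast
    then have "U \<noteq> {}" unfolding U_def by auto
    have "open (F ` U)"
      using invariance_of_domain[OF continuous_on_subset[OF F(1) subset_UNIV] \<open>open U\<close>]
        inj_on_subset[OF F(2) subset_UNIV] by blast
    then have "open ((\<lambda>z. snd (F z)) ` U)" using open_image_snd[of "F ` U"] by (simp add: image_image)
    then obtain z where z: "z \<in> U" "\<And>j. j \<in> I \<Longrightarrow> snd (F z) - snd (F (x j)) \<notin> \<int>"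
      using open_avoids_integer_translates[of "\<lambda>z. snd (F z)" U I "\<lambda>j. snd (F (x j))"] \<open>U \<noteq> {}\<close> insert.hyps(1) by blast
    have z1: "fst z - fst (x j) \<notin> \<int>" if "j \<in> I" for j using z(1) that by (auto simp: U_def)
    have sym: "a - b \<notin> \<int> \<Longrightarrow> b - a \<notin> \<int>" for a b :: real using minus_in_Ints_iff[of "a - b"] by simp
    show ?case
    proof (intro exI[of _ "x(k := z)"] conjI ballI impI)
      fix i assume "i \<in> insert k I"
      then show "dist ((x(k := z)) i) (c i) < \<eta>"
        using x(1) z(1) by (auto simp: U_def dist_commute)
    next
      fix i j assume ij: "i \<in> insert k I" "j \<in> insert k I" "i \<noteq> j"
      show "fst ((x(k := z)) i) - fst ((x(k := z)) j) \<notin> \<int>"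
        using ij x(2) z1 sym[OF z1] by (cases "i = k"; cases "j = k") auto
      show "snd (F ((x(k := z)) i)) - snd (F ((x(k := z)) j)) \<notin> \<int>"
        using ij x(2) z(2) sym[OF z(2)] by (cases "i = k"; cases "j = k") auto
    qed
  qed auto
  with that show thesis by metis
qed

text \<open>
  All points of all loops are moved into general position at the same time. This keeps the steps
  \<open>3 \<delta>\<close>-close, and a pair of shears then takes the image of each point to its successor in the loop.
  At the end of a loop the successor is the translate of the initial point by \<open>w t\<close>.
\<close>

lemma realise_pseudo_loops:
  fixes m :: "'t \<Rightarrow> nat" and w :: "'t \<Rightarrow> plane" and c :: "'t \<Rightarrow> nat \<Rightarrow> plane"
  assumes F: "equivariant F" "continuous_on UNIV F" "inj F" and \<delta>: "\<delta> > 0" and T: "finite T"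
    and loop: "\<And>t. t \<in> T \<Longrightarrow> pseudo_loop F \<delta> (m t) (w t) (c t)"
  obtains H K where "equivariant H" "continuous_on UNIV H" "equivariant K" "continuous_on UNIV K"
    "\<And>z. K (H z) = z" "\<And>z. H (K z) = z" "\<And>z. dist (H z) z \<le> 6 * \<delta>"
    "\<And>t. t \<in> T \<Longrightarrow> \<exists>z. ((H \<circ> F) ^^ m t) z = z + w t"
proof -
  obtain d where d: "d > 0" "\<And>x y. dist x y < d \<Longrightarrow> dist (F x) (F y) < \<delta>"
    using equivariant_uniformly_continuous[OF F(1,2)] \<delta> unfolding uniformly_continuous_on_def
    by (metis UNIV_I)
  define I where "I = Sigma T (\<lambda>t. {..<m t})"
  have "finite I" using T by (auto simp: I_def)
  obtain x where x: "\<And>i. i \<in> I \<Longrightarrow> dist (x i) (case_prod c i) < min d \<delta>"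
    "\<And>i j. i \<in> I \<Longrightarrow> j \<in> I \<Longrightarrow> i \<noteq> j \<Longrightarrow> fst (x i) - fst (x j) \<notin> \<int>"
    "\<And>i j. i \<in> I \<Longrightarrow> j \<in> I \<Longrightarrow> i \<noteq> j \<Longrightarrow> snd (F (x i)) - snd (F (x j)) \<notin> \<int>"
    using general_position[OF F(2,3) \<open>finite I\<close>, of "min d \<delta>" "case_prod c"] d(1) \<delta> by auto
  define succ where "succ i = (fst i, if Suc (snd i) < m (fst i) then Suc (snd i) else 0)" for i :: "'t \<times> nat"
  define shift where "shift i = (if Suc (snd i) < m (fst i) then 0 else w (fst i))" for i :: "'t \<times> nat"
  define b where "b i = x (succ i) + shift i" for i
  have l: "m t \<ge> 1" "w t \<in> lattice" "c t (m t) = c t 0 + w t" "\<And>j. j < m t \<Longrightarrow> dist (F (c t j)) (c t (Suc j)) < \<delta>"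
    if "t \<in> T" for t using loop[OF that] unfolding pseudo_loop_def by auto
  have succI: "succ i \<in> I" if "i \<in> I" for i using that l(1) by (auto simp: I_def succ_def)
  have succ_inj: "succ i \<noteq> succ j" if "i \<in> I" "j \<in> I" "i \<noteq> j" for i j
    using that by (auto simp: I_def succ_def split: if_splits)
  have shift: "shift i \<in> lattice" if "i \<in> I" for i
    using that l(2) zero_in_lattice by (auto simp: I_def shift_def simp del: mem_Sigma_iff)
  have csucc: "c (fst i) (Suc (snd i)) = case_prod c (succ i) + shift i" if "i \<in> I" for i
  proof (cases "Suc (snd i) < m (fst i)")
    case True then show ?thesis by (simp add: succ_def shift_def)
  next
    case False
    then have "Suc (snd i) = m (fst i)" "fst i \<in> T" using that by (auto simp: I_def)
    then show ?thesis using l(3) by (simp add: succ_def shift_def)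
  qed
  have ab: "dist (F (x i)) (b i) \<le> 3 * \<delta>" if i: "i \<in> I" for i
  proof -
    let ?y = "c (fst i) (snd i)" and ?y' = "c (fst i) (Suc (snd i))"
    have "dist (F (x i)) (F ?y) < \<delta>" using x(1)[OF i] by (intro d(2)) (simp add: case_prod_beta)
    moreover have "dist (F ?y) ?y' < \<delta>" using i l(4) by (auto simp: I_def)
    moreover have "dist ?y' (b i) < \<delta>"
      unfolding csucc[OF i] b_def using x(1)[OF succI[OF i]] by (simp add: dist_commute)
    ultimately show ?thesis
      using dist_triangle[of "F (x i)" "b i" "F ?y"] dist_triangle[of "F ?y" "b i" ?y'] by simp
  qed
  have bfst: "fst (b i) - fst (b j) \<notin> \<int>" if ij: "i \<in> I" "j \<in> I" "i \<noteq> j" for i j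
  proof
    assume "fst (b i) - fst (b j) \<in> \<int>"
    moreover have "fst (shift i) \<in> \<int>" "fst (shift j) \<in> \<int>"
      using shift ij unfolding mem_Times_iff by blast+
    ultimately have "fst (b i) - fst (b j) - (fst (shift i) - fst (shift j)) \<in> \<int>" by (meson Ints_diff)
    then show False using x(2)[OF succI[OF ij(1)] succI[OF ij(2)] succ_inj[OF ij]] by (simp add: b_def)
  qed
  have r0: "3 * \<delta> \<ge> 0" using \<delta> by simp
  show thesis
  proof (rule shear_matching[where a = "\<lambda>i. F (x i)" and b = b, OF \<open>finite I\<close> r0 x(3) bfst ab])
    fix H K assume HK: "equivariant H" "continuous_on UNIV H" "equivariant K" "continuous_on UNIV K"
      "\<And>z. K (H z) = z" "\<And>z. H (K z) = z" "\<And>z. dist (H z) z \<le> 2 * (3 * \<delta>)"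
      "\<And>i. i \<in> I \<Longrightarrow> H (F (x i)) = b i"
    have per: "\<exists>z. ((H \<circ> F) ^^ m t) z = z + w t" if t: "t \<in> T" for t
    proof
      have "((H \<circ> F) ^^ j) (x (t, 0)) = x (t, j)" if "j < m t" for j
        using that
      proof (induction j)
        case (Suc j)
        then have "(t, j) \<in> I" using t by (simp add: I_def)
        then show ?case using Suc HK(8)[of "(t, j)"] by (simp add: b_def succ_def shift_def)
      qed simp
      from this[of "m t - 1"] have "((H \<circ> F) ^^ (m t - 1)) (x (t, 0)) = x (t, m t - 1)" using l(1)[OF t] by simp
      moreover have "(t, m t - 1) \<in> I" using t l(1)[OF t] by (simp add: I_def)
      then have "H (F (x (t, m t - 1))) = x (t, 0) + w t"
        using HK(8)[of "(t, m t - 1)"] l(1)[OF t] by (simp add: b_def succ_def shift_def)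
      moreover have "m t = Suc (m t - 1)" using l(1)[OF t] by simp
      ultimately show "((H \<circ> F) ^^ m t) (x (t, 0)) = x (t, 0) + w t"
        by (metis comp_apply funpow.simps(2))
    qed
    show thesis
      using that[OF HK(1-6) _ per] HK(7) by simp
  qed
qed

section \<open>Images of the unit square are almost convex\<close>

text \<open>
  Let \<open>(s1, s2)\<close> be an arch in the upper half-plane with its feet on the axis to the left and to the right of a
  disc of radius \<open>r\<close> around the origin that it avoids, and let \<open>(k1, k2)\<close> be a path above the axis from
  inside the disc to a point at least as high as the whole arch. Extend the arch
  along the axis to both sides of a large box, and extend the path from its initial
  point straight down to the axis. Then one connects the left side to the right side and the other the
  bottom to the top, so they cross by the Fashoda meet theorem. The added segments cannot take part in
  the crossing: the horizontal ones are on the axis but off the disc, and the vertical one is in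
  the disc.
\<close>

lemma arch_meets_rising_path:
  fixes s1 s2 k1 k2 :: "real \<Rightarrow> real"
  assumes cont: "continuous_on {0..1} s1" "continuous_on {0..1} s2" "continuous_on {0..1} k1" "continuous_on {0..1} k2"
    and s: "\<And>t. t \<in> {0..1} \<Longrightarrow> 0 \<le> s2 t" "\<And>t. t \<in> {0..1} \<Longrightarrow> r\<^sup>2 \<le> (s1 t)\<^sup>2 + (s2 t)\<^sup>2"
      "s2 0 = 0" "s2 1 = 0" "s1 0 \<le> - r" "r \<le> s1 1" "r > 0"
    and k: "\<And>t. t \<in> {0..1} \<Longrightarrow> 0 < k2 t" "(k1 0)\<^sup>2 + (k2 0)\<^sup>2 < r\<^sup>2"
      "\<And>t. t \<in> {0..1} \<Longrightarrow> k2 t \<le> k2 1" "\<And>t. t \<in> {0..1} \<Longrightarrow> s2 t \<le> k2 1"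
  shows "\<exists>t\<in>{0..1}. \<exists>u\<in>{0..1}. s1 t = k1 u \<and> s2 t = k2 u"
proof -
  define S :: "real \<Rightarrow> real^2" where "S t = vector [s1 t, s2 t]" for t
  define K :: "real \<Rightarrow> real^2" where "K t = vector [k1 t, k2 t]" for t
  have bound: "\<exists>B. \<forall>t\<in>{0..1}. \<bar>h t\<bar> \<le> B" if "continuous_on {0..1} h" for h :: "real \<Rightarrow> real"
  proof -
    have "bounded (h ` {0..1})" using that by (intro compact_imp_bounded compact_continuous_image) auto
    then show ?thesis unfolding bounded_iff by auto
  qed
  obtain B1 B2 where B: "\<And>t. t \<in> {0..1} \<Longrightarrow> \<bar>s1 t\<bar> \<le> B1" "\<And>t. t \<in> {0..1} \<Longrightarrow> \<bar>k1 t\<bar> \<le> B2"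
    using bound[OF cont(1)] bound[OF cont(3)] by blast
  define M where "M = max B1 B2"
  have M: "\<bar>s1 t\<bar> \<le> M" "\<bar>k1 t\<bar> \<le> M" if "t \<in> {0..1}" for t
    using B that unfolding M_def le_max_iff_disj by blast+
  define a b P Q V :: "real^2" where "a = vector [- M, 0]" and "b = vector [M, k2 1]"
    and "P = vector [- M, 0]" and "Q = vector [M, 0]" and "V = vector [k1 0, 0]"
  have pvec: "path (\<lambda>t. vector [f t, g t] :: real^2)" if "continuous_on {0..1} f" "continuous_on {0..1} g" for f g :: "real \<Rightarrow> real"
  proof -
    have "(vector [f t, g t] :: real^2) = (\<chi> i. if i = 1 then f t else g t)" for t
      by (simp add: vec_eq_iff forall_2)
    moreover have "continuous_on {0..1} (\<lambda>t. if i = 1 then f t else g t)" for i :: 2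
      using that by (cases "i = 1") simp_all
    ultimately show ?thesis unfolding path_def by (simp add: continuous_on_vec_lambda)
  qed
  have pS: "path S" and pK: "path K"
    using pvec[OF cont(1,2)] pvec[OF cont(3,4)] unfolding S_def K_def by simp_all
  have ends: "pathstart S = vector [s1 0, 0]" "pathfinish S = vector [s1 1, 0]"
    "pathstart K = vector [k1 0, k2 0]" "pathfinish K = vector [k1 1, k2 1]"
    by (simp_all add: pathstart_def pathfinish_def S_def K_def s)
  let ?f = "linepath P (pathstart S) +++ S +++ linepath (pathfinish S) Q"
  let ?g = "linepath V (pathstart K) +++ K"
  have imf: "path_image ?f = closed_segment P (pathstart S) \<union> path_image S \<union> closed_segment (pathfinish S) Q"
    by (simp add: path_image_join Un_assoc)
  have img: "path_image ?g = closed_segment V (pathstart K) \<union> path_image K"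
    by (simp add: path_image_join)
  have box: "z \<in> cbox a b \<longleftrightarrow> - M \<le> z $ 1 \<and> z $ 1 \<le> M \<and> 0 \<le> z $ 2 \<and> z $ 2 \<le> k2 1" for z
    by (auto simp: mem_box_cart forall_2 a_def b_def)
  have h0: "0 < k2 0" "0 < k2 1" "k2 0 \<le> k2 1" using k(1)[of 0] k(1)[of 1] k(3)[of 0] by auto
  have M0: "\<bar>s1 0\<bar> \<le> M" "\<bar>s1 1\<bar> \<le> M" "\<bar>k1 0\<bar> \<le> M" using M[of 0] M[of 1] by auto
  have "S t \<in> cbox a b" "K t \<in> cbox a b" if "t \<in> {0..1}" for t
    using s(1)[OF that] k(1,3,4)[OF that] M[OF that] by (simp_all add: box S_def K_def abs_le_iff)
  then have "path_image S \<subseteq> cbox a b" "path_image K \<subseteq> cbox a b"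
    unfolding path_image_def by blast+
  moreover have "closed_segment P (pathstart S) \<subseteq> cbox a b" "closed_segment (pathfinish S) Q \<subseteq> cbox a b"
    "closed_segment V (pathstart K) \<subseteq> cbox a b"
    using M0 h0 by (intro closed_segment_subset convex_box; auto simp: box ends P_def Q_def V_def)+
  ultimately have sub: "path_image ?f \<subseteq> cbox a b" "path_image ?g \<subseteq> cbox a b"
    unfolding imf img by auto
  obtain z where z: "z \<in> path_image ?f" "z \<in> path_image ?g"
  proof (rule fashoda[OF _ _ sub])
    show "path ?f" "path ?g" using pS pK by auto
  qed (simp_all add: a_def b_def P_def Q_def V_def ends)
  have left: "z $ 2 = 0 \<and> z $ 1 \<le> - r" if "z \<in> closed_segment P (pathstart S)"
  proof -
    from that obtain u where u: "0 \<le> u" "u \<le> 1" "z = (1 - u) *\<^sub>R P + u *\<^sub>R pathstart S"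
      unfolding in_segment by blast
    have "(1 - u) * (- M) + u * s1 0 \<le> - r" using u M0 s(5) by (intro convex_bound_le) auto
    then show ?thesis using u by (simp add: ends P_def)
  qed
  have right: "z $ 2 = 0 \<and> r \<le> z $ 1" if "z \<in> closed_segment (pathfinish S) Q"
  proof -
    from that obtain u where u: "0 \<le> u" "u \<le> 1" "z = (1 - u) *\<^sub>R pathfinish S + u *\<^sub>R Q"
      unfolding in_segment by blast
    have "(1 - u) * (- s1 1) + u * (- M) \<le> - r" using u M0 s(6) by (intro convex_bound_le) auto
    then show ?thesis using u by (simp add: ends Q_def)
  qed
  have down: "z $ 1 = k1 0 \<and> 0 \<le> z $ 2 \<and> z $ 2 \<le> k2 0" if "z \<in> closed_segment V (pathstart K)"
  proof -
    from that obtain u where u: "0 \<le> u" "u \<le> 1" "z = (1 - u) *\<^sub>R V + u *\<^sub>R pathstart K"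
      unfolding in_segment by blast
    then have "z $ 1 = (1 - u) * k1 0 + u * k1 0" "z $ 2 = u * k2 0" by (simp_all add: ends V_def)
    moreover have "(1 - u) * k1 0 + u * k1 0 = k1 0" by (simp add: left_diff_distrib)
    ultimately show ?thesis using h0 u(1,2) by (simp add: mult_left_le_one_le)
  qed
  have Sim: "\<exists>t\<in>{0..1}. z $ 1 = s1 t \<and> z $ 2 = s2 t" if "z \<in> path_image S"
    using that by (auto simp: path_image_def S_def)
  have Kim: "\<exists>t\<in>{0..1}. z $ 1 = k1 t \<and> z $ 2 = k2 t" if "z \<in> path_image K"
    using that by (auto simp: path_image_def K_def)
  have "\<bar>k1 0\<bar> < r"
  proof -
    have "(k1 0)\<^sup>2 < r\<^sup>2" using k(2) zero_le_power2[of "k2 0"] by linarith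
    then show ?thesis using s(7) by (metis abs_le_square_iff abs_of_pos linorder_not_le)
  qed
  have notdown: "z \<notin> closed_segment V (pathstart K)" if "z \<in> path_image S"
  proof
    assume "z \<in> closed_segment V (pathstart K)"
    from down[OF this] Sim[OF that] obtain t where t: "t \<in> {0..1}" "s1 t = k1 0" "0 \<le> s2 t" "s2 t \<le> k2 0" by auto
    then have "(s2 t)\<^sup>2 \<le> (k2 0)\<^sup>2" by (intro power_mono)
    then show False using s(2)[OF t(1)] k(2) t(2) by simp
  qed
  have off_ends: False if "z $ 2 = 0" "\<bar>z $ 1\<bar> \<ge> r"
  proof -
    from z(2) consider "z \<in> closed_segment V (pathstart K)" | "z \<in> path_image K" unfolding img by blast
    then show False
    proof cases
      case 1 then show False using down that(2) \<open>\<bar>k1 0\<bar> < r\<close> by simp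
    next
      case 2
      then obtain t where "t \<in> {0..1}" "z $ 2 = k2 t" using Kim by blast
      with k(1)[of t] that(1) show False by simp
    qed
  qed
  have "z \<in> path_image S"
  proof (rule ccontr)
    assume "z \<notin> path_image S"
    then have "z \<in> closed_segment P (pathstart S) \<or> z \<in> closed_segment (pathfinish S) Q"
      using z(1) unfolding imf by blast
    then have "z $ 2 = 0 \<and> \<bar>z $ 1\<bar> \<ge> r" using left right s(7) by auto
    then show False using off_ends by blast
  qed
  moreover from this have "z \<in> path_image K" using z(2) notdown unfolding img by auto
  ultimately show ?thesis using Sim Kim by metis
qed

text \<open>
  The coordinates \<open>X\<close> and \<open>Y\<close> are centred at \<open>p\<close> and rotated so that the feet of the arch \<open>\<gamma>\<close> are on the
  axis \<open>Y = 0\<close>. Half of the disc of radius 2 lies under the arch and contains a translate \<open>\<gamma> 0 + w\<close> of the left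
  foot. Since \<open>w\<close> points upwards, the translated arch stays above the axis and its
  top is higher than the whole of \<open>\<gamma>\<close>: it starts under the arch and has to leave through it.
\<close>

lemma arch_meets_lattice_translate:
  fixes \<gamma> :: "real \<Rightarrow> plane" and p :: plane and c s :: real
  assumes X_def: "\<And>z. X z = c * (fst z - fst p) + s * (snd z - snd p)"
    and Y_def: "\<And>z. Y z = c * (snd z - snd p) - s * (fst z - fst p)"
    and cs: "c\<^sup>2 + s\<^sup>2 = 1" and \<gamma>: "continuous_on {0..1} \<gamma>"
    and far: "\<And>t. t \<in> {0..1} \<Longrightarrow> 2 \<le> dist (\<gamma> t) p"
    and up: "\<And>t. t \<in> {0..1} \<Longrightarrow> 0 \<le> Y (\<gamma> t)"
    and ends: "Y (\<gamma> 0) = 0" "Y (\<gamma> 1) = 0" "X (\<gamma> 0) \<le> 0" "0 \<le> X (\<gamma> 1)"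
  shows "\<exists>w\<in>lattice. w \<noteq> 0 \<and> (\<exists>t\<in>{0..1}. \<exists>u\<in>{0..1}. \<gamma> t = \<gamma> u + w)"
proof -
  have XY: "(X z)\<^sup>2 + (Y z)\<^sup>2 = (dist z p)\<^sup>2" for z
  proof -
    have "(X z)\<^sup>2 + (Y z)\<^sup>2 = (c\<^sup>2 + s\<^sup>2) * ((fst z - fst p)\<^sup>2 + (snd z - snd p)\<^sup>2)"
      unfolding X_def Y_def by algebra
    then show ?thesis by (simp add: cs dist_norm norm_prod_def)
  qed
  have inj: "z = z'" if "X z = X z'" "Y z = Y z'" for z z'
  proof -
    have "(c\<^sup>2 + s\<^sup>2) * (fst z - fst z') = 0" "(c\<^sup>2 + s\<^sup>2) * (snd z - snd z') = 0"
      using that unfolding X_def Y_def by algebra+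
    then show ?thesis by (simp add: cs prod_eq_iff)
  qed
  have contXY: "continuous_on UNIV X" "continuous_on UNIV Y"
    unfolding X_def Y_def by (intro continuous_intros)+
  \<comment> \<open>The disc of radius 1 around \<open>n\<close> touches the axis from above and is in the disc of radius 2 around \<open>p\<close>.\<close>
  define n where "n = p + (- s, c)"
  obtain w where w: "w \<in> lattice" "dist (\<gamma> 0 + w) n < 1" by (rule obtain_lattice_translate_near)
  define h where "h = Y (\<gamma> 0 + w)"
  have Yw: "Y (z + w) = Y z + h" for z
    unfolding h_def using ends(1) by (simp add: Y_def algebra_simps)
  have Xn: "X n = 0" "Y n = 1" using cs by (simp_all add: n_def X_def Y_def power2_eq_square)
  have dn: "dist n p = 1" using XY[of n] Xn by (simp add: power2_eq_1_iff) (metis abs_of_nonneg abs_minus_cancel abs_one zero_le_dist)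
  have near: "dist (\<gamma> 0 + w) p < 2" using w(2) dn dist_triangle[of "\<gamma> 0 + w" p n] by simp
  have "h > 0"
  proof -
    have "(Y (\<gamma> 0 + w) - Y n)\<^sup>2 \<le> (dist (\<gamma> 0 + w) n)\<^sup>2"
    proof -
      let ?x = "fst (\<gamma> 0 + w) - fst n" and ?y = "snd (\<gamma> 0 + w) - snd n"
      have e: "Y (\<gamma> 0 + w) - Y n = c * ?y - s * ?x" unfolding Y_def by algebra
      have "(c * ?y - s * ?x)\<^sup>2 + (c * ?x + s * ?y)\<^sup>2 = (c\<^sup>2 + s\<^sup>2) * (?x\<^sup>2 + ?y\<^sup>2)" by algebra
      then have "(c * ?y - s * ?x)\<^sup>2 + (c * ?x + s * ?y)\<^sup>2 = ?x\<^sup>2 + ?y\<^sup>2" by (simp only: cs mult_1)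
      moreover have "(dist (\<gamma> 0 + w) n)\<^sup>2 = ?x\<^sup>2 + ?y\<^sup>2" by (simp add: dist_norm norm_prod_def)
      ultimately show ?thesis unfolding e using zero_le_power2[of "c * ?x + s * ?y"] by linarith
    qed
    then have "\<bar>h - 1\<bar> \<le> dist (\<gamma> 0 + w) n" unfolding h_def Xn(2) by (metis abs_le_square_iff abs_of_nonneg zero_le_dist)
    then show ?thesis using w(2) by linarith
  qed
  have "w \<noteq> 0" using \<open>h > 0\<close> ends(1) by (auto simp: h_def)
  have contY: "continuous_on {0..1} (\<lambda>t. Y (\<gamma> t))" and contX: "continuous_on {0..1} (\<lambda>t. X (\<gamma> t))"
    by (rule continuous_on_compose2[OF contXY(2) \<gamma>] continuous_on_compose2[OF contXY(1) \<gamma>]; simp)+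
  \<comment> \<open>The translated arch is followed up to its highest point only.\<close>
  obtain T where T: "T \<in> {0..1}" "\<And>t. t \<in> {0..1} \<Longrightarrow> Y (\<gamma> t) \<le> Y (\<gamma> T)"
    using continuous_attains_sup[OF compact_Icc _ contY] by auto
  have Tt: "T * t \<in> {0..1}" if "t \<in> {0..1}" for t using that T(1) by (auto intro: mult_le_one)
  have contk: "continuous_on {0..1} (\<lambda>t. \<gamma> (T * t) + w)"
    by (intro continuous_intros continuous_on_compose2[OF \<gamma>]) (use Tt in auto)
  have "\<exists>t\<in>{0..1}. \<exists>u\<in>{0..1}. X (\<gamma> t) = X (\<gamma> (T * u) + w) \<and> Y (\<gamma> t) = Y (\<gamma> (T * u) + w)"
  proof (rule arch_meets_rising_path[where r = 2])
    show "continuous_on {0..1} (\<lambda>t. X (\<gamma> t))" "continuous_on {0..1} (\<lambda>t. Y (\<gamma> t))" by fact+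
    show "continuous_on {0..1} (\<lambda>t. X (\<gamma> (T * t) + w))" by (rule continuous_on_compose2[OF contXY(1) contk]) simp
    show "continuous_on {0..1} (\<lambda>t. Y (\<gamma> (T * t) + w))" by (rule continuous_on_compose2[OF contXY(2) contk]) simp
    show "0 \<le> Y (\<gamma> t)" if "t \<in> {0..1}" for t using up that .
    show o: "2\<^sup>2 \<le> (X (\<gamma> t))\<^sup>2 + (Y (\<gamma> t))\<^sup>2" if "t \<in> {0..1}" for t
      unfolding XY using far[OF that] by (intro power_mono) auto
    show "Y (\<gamma> 0) = 0" "Y (\<gamma> 1) = 0" by fact+
    have "2 \<le> \<bar>X (\<gamma> 0)\<bar>" "2 \<le> \<bar>X (\<gamma> 1)\<bar>"
      using o[of 0] o[of 1] ends abs_le_square_iff[of 2 "X (\<gamma> 0)"] abs_le_square_iff[of 2 "X (\<gamma> 1)"]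
      by simp_all
    then show "X (\<gamma> 0) \<le> - 2" "2 \<le> X (\<gamma> 1)" using ends by auto
    show "0 < Y (\<gamma> (T * t) + w)" if "t \<in> {0..1}" for t
      unfolding Yw using up[OF Tt[OF that]] \<open>h > 0\<close> by simp
    show "(X (\<gamma> (T * 0) + w))\<^sup>2 + (Y (\<gamma> (T * 0) + w))\<^sup>2 < 2\<^sup>2"
      unfolding XY using near by (intro power_strict_mono) auto
    show "Y (\<gamma> (T * t) + w) \<le> Y (\<gamma> (T * 1) + w)" if "t \<in> {0..1}" for t
      unfolding Yw using T(2)[OF Tt[OF that]] by simp
    show "Y (\<gamma> t) \<le> Y (\<gamma> (T * 1) + w)" if "t \<in> {0..1}" for t
      unfolding Yw using T(2)[OF that] \<open>h > 0\<close> by simp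
  qed simp
  then obtain t u where "t \<in> {0..1}" "u \<in> {0..1}" "\<gamma> t = \<gamma> (T * u) + w" using inj by blast
  then show ?thesis using w(1) \<open>w \<noteq> 0\<close> Tt by blast
qed


text \<open>
  If the image \<open>\<gamma>\<close> of the segment from \<open>a\<close> to \<open>b\<close> avoids the disc of radius 2 around \<open>p\<close>, it has a last
  passage through the part of the line from \<open>\<Phi> a\<close> to \<open>\<Phi> b\<close> before the disc, and after it a first passage through the
  part behind the disc. In between it stays on one side of the line, so it is an arch, up
  to a rotation by \<open>\<pi>\<close> that exchanges the two sides, and meets a translate of itself by a non-zero integer vector. But points
  of the half-open unit square have disjoint translates, and \<open>\<Phi>\<close> is injective.
\<close>

lemma segment_near_image:
  assumes \<Phi>: "equivariant \<Phi>" "continuous_on UNIV \<Phi>" "inj \<Phi>"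
    and ab: "a \<in> {0..<1} \<times> {0..<1}" "b \<in> {0..<1} \<times> {0..<1}"
    and p: "p \<in> closed_segment (\<Phi> a) (\<Phi> b)"
  shows "\<exists>d\<in>{0..<1} \<times> {0..<1}. dist (\<Phi> d) p < 2"
proof (rule ccontr)
  let ?D = "{0..<1::real} \<times> {0..<1::real}"
  assume "\<not> ?thesis"
  then have far: "2 \<le> dist (\<Phi> d) p" if "d \<in> ?D" for d using that by (meson linorder_not_le)
  define \<gamma> where "\<gamma> t = \<Phi> (linepath a b t)" for t
  have "convex ?D" by (intro convex_Times) auto
  have D: "linepath a b t \<in> ?D" if "t \<in> {0..1}" for t
    by (rule subsetD[OF closed_segment_subset[OF ab \<open>convex ?D\<close>] linepath_in_path[OF that]])
  have cont\<gamma>: "continuous_on A \<gamma>" for A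
    unfolding \<gamma>_def by (rule continuous_on_compose2[OF \<Phi>(2) continuous_on_linepath]) simp
  have disjoint: "\<gamma> t \<noteq> \<gamma> u + w" if "t \<in> {0..1}" "u \<in> {0..1}" "w \<in> lattice" "w \<noteq> 0" for t u w
  proof
    assume "\<gamma> t = \<gamma> u + w"
    then have "linepath a b t = linepath a b u + w"
      using equivariantD[OF \<Phi>(1) that(3)] injD[OF \<Phi>(3)] by (metis \<gamma>_def)
    then have w: "w = linepath a b t - linepath a b u" by simp
    have "\<bar>fst w\<bar> < 1" "\<bar>snd w\<bar> < 1"
      using D[OF that(1)] D[OF that(2)] unfolding w by (auto simp: mem_Times_iff)
    then have "fst w = 0" "snd w = 0" using that(3) Ints_nonzero_abs_less1 by (auto simp: mem_Times_iff)
    then show False using that(4) by (simp add: prod_eq_iff)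
  qed
  have far\<gamma>: "2 \<le> dist (\<gamma> t) p" if "t \<in> {0..1}" for t
    unfolding \<gamma>_def using far[OF D[OF that]] .
  have \<gamma>01: "\<gamma> 0 = \<Phi> a" "\<gamma> 1 = \<Phi> b" by (simp_all add: \<gamma>_def linepath_def)
  define L where "L = dist (\<Phi> a) (\<Phi> b)"
  have "L > 0"
  proof -
    have "2 \<le> dist (\<Phi> a) p" using far ab by simp
    also have "dist (\<Phi> a) p \<le> L" unfolding L_def using p by (metis dist_in_closed_segment dist_commute)
    finally show ?thesis by simp
  qed
  define c s where "c = (fst (\<Phi> b) - fst (\<Phi> a)) / L" and "s = (snd (\<Phi> b) - snd (\<Phi> a)) / L"
  have L2: "L\<^sup>2 = (fst (\<Phi> b) - fst (\<Phi> a))\<^sup>2 + (snd (\<Phi> b) - snd (\<Phi> a))\<^sup>2"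
    by (simp add: L_def dist_norm norm_prod_def power2_commute)
  have "c\<^sup>2 + s\<^sup>2 = L\<^sup>2 / L\<^sup>2"
    unfolding L2 by (simp only: c_def s_def power_divide L2 add_divide_distrib)
  then have cs: "c\<^sup>2 + s\<^sup>2 = 1" using \<open>L > 0\<close> by simp
  define X where "X z = c * (fst z - fst p) + s * (snd z - snd p)" for z
  define Y where "Y z = c * (snd z - snd p) - s * (fst z - fst p)" for z
  obtain \<mu> where \<mu>: "0 \<le> \<mu>" "\<mu> \<le> 1" "p = (1 - \<mu>) *\<^sub>R \<Phi> a + \<mu> *\<^sub>R \<Phi> b"
    using p unfolding in_segment by blast
  have cL: "c * L = fst (\<Phi> b) - fst (\<Phi> a)" "s * L = snd (\<Phi> b) - snd (\<Phi> a)"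
    using \<open>L > 0\<close> by (simp_all add: c_def s_def)
  have pc: "fst (\<Phi> a) - fst p = - \<mu> * (c * L)" "snd (\<Phi> a) - snd p = - \<mu> * (s * L)"
    "fst (\<Phi> b) - fst p = (1 - \<mu>) * (c * L)" "snd (\<Phi> b) - snd p = (1 - \<mu>) * (s * L)"
    unfolding cL \<mu>(3) by (simp_all add: algebra_simps)
  have "X (\<Phi> a) = - \<mu> * L * (c\<^sup>2 + s\<^sup>2)" "X (\<Phi> b) = (1 - \<mu>) * L * (c\<^sup>2 + s\<^sup>2)"
    "Y (\<Phi> a) = 0" "Y (\<Phi> b) = 0"
    unfolding X_def Y_def pc by algebra+
  then have ends: "X (\<gamma> 0) \<le> 0" "0 \<le> X (\<gamma> 1)" "Y (\<gamma> 0) = 0" "Y (\<gamma> 1) = 0"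
    using \<mu> \<open>L > 0\<close> by (simp_all add: cs \<gamma>01)
  have contX: "continuous_on A (\<lambda>t. X (\<gamma> t))" and contY: "continuous_on A (\<lambda>t. Y (\<gamma> t))" for A
    unfolding X_def Y_def by (intro continuous_intros cont\<gamma>)+
  have XY: "(X z)\<^sup>2 + (Y z)\<^sup>2 = (dist z p)\<^sup>2" for z
  proof -
    have "(X z)\<^sup>2 + (Y z)\<^sup>2 = (c\<^sup>2 + s\<^sup>2) * ((fst z - fst p)\<^sup>2 + (snd z - snd p)\<^sup>2)"
      unfolding X_def Y_def by algebra
    then show ?thesis by (simp add: cs dist_norm norm_prod_def)
  qed
  define P where "P = {0..1} \<inter> ({t. Y (\<gamma> t) = 0} \<inter> {t. X (\<gamma> t) \<le> 0})"
  have "compact P" unfolding P_def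
    by (intro compact_Int_closed compact_Icc closed_Int closed_Collect_eq closed_Collect_le contX contY continuous_on_const)
  moreover have "0 \<in> P" using ends by (simp add: P_def)
  ultimately obtain t0 where t0: "t0 \<in> P" "\<And>t. t \<in> P \<Longrightarrow> t \<le> t0"
    using compact_attains_sup[of P] by auto
  define Q where "Q = {t0..1} \<inter> ({t. Y (\<gamma> t) = 0} \<inter> {t. 0 \<le> X (\<gamma> t)})"
  have "compact Q" unfolding Q_def
    by (intro compact_Int_closed compact_Icc closed_Int closed_Collect_eq closed_Collect_le contX contY continuous_on_const)
  moreover have "1 \<in> Q" using ends t0(1) by (simp add: Q_def P_def)
  ultimately obtain t1 where t1: "t1 \<in> Q" "\<And>t. t \<in> Q \<Longrightarrow> t1 \<le> t"
    using compact_attains_inf[of Q] by auto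
  have t01: "0 \<le> t0" "t0 \<le> t1" "t1 \<le> 1" "Y (\<gamma> t0) = 0" "Y (\<gamma> t1) = 0" "X (\<gamma> t0) \<le> 0" "0 \<le> X (\<gamma> t1)"
    using t0(1) t1(1) by (auto simp: P_def Q_def)
  have nonzero: "Y (\<gamma> t) \<noteq> 0" if "t \<in> {t0<..<t1}" for t
  proof
    assume "Y (\<gamma> t) = 0"
    then have "t \<in> P \<or> t \<in> Q" using that t01 by (auto simp: P_def Q_def)
    then show False using t0(2)[of t] t1(2)[of t] that by auto
  qed
  have "connected ((\<lambda>t. Y (\<gamma> t)) ` {t0<..<t1})"
    by (intro connected_continuous_image contY) auto
  then have "\<not> (Y (\<gamma> t) \<le> 0 \<and> 0 \<le> Y (\<gamma> u))" if "t \<in> {t0<..<t1}" "u \<in> {t0<..<t1}" for t u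
    using nonzero connectedD_interval[of "(\<lambda>t. Y (\<gamma> t)) ` {t0<..<t1}" "Y (\<gamma> t)" "Y (\<gamma> u)" 0] that by auto
  then consider "\<forall>t\<in>{t0<..<t1}. 0 \<le> Y (\<gamma> t)" | "\<forall>t\<in>{t0<..<t1}. Y (\<gamma> t) \<le> 0"
    by (meson linear)
  then have "\<exists>w\<in>lattice. w \<noteq> 0 \<and> (\<exists>t\<in>{0..1}. \<exists>u\<in>{0..1}. \<gamma> t = \<gamma> u + w)"
  proof cases
    case 1
    then have up: "0 \<le> Y (\<gamma> t)" if "t0 \<le> t" "t \<le> t1" for t
      using t01(4,5) that by (cases "t = t0 \<or> t = t1") auto
    define \<rho> where "\<rho> u = t0 + u * (t1 - t0)" for u
    have \<rho>: "t0 \<le> \<rho> u" "\<rho> u \<le> t1" if "u \<in> {0..1}" for u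
      using that t01(2) mult_left_le_one_le[of "t1 - t0" u] by (auto simp: \<rho>_def)
    have \<rho>01: "\<rho> u \<in> {0..1}" if "u \<in> {0..1}" for u using \<rho>[OF that] t01(1,3) by auto
    have "\<exists>w\<in>lattice. w \<noteq> 0 \<and> (\<exists>t\<in>{0..1}. \<exists>u\<in>{0..1}. \<gamma> (\<rho> t) = \<gamma> (\<rho> u) + w)"
    proof (rule arch_meets_lattice_translate[OF X_def Y_def cs])
      show "continuous_on {0..1} (\<lambda>t. \<gamma> (\<rho> t))"
        by (rule continuous_on_compose2[OF cont\<gamma>[of UNIV]]) (auto simp: \<rho>_def intro!: continuous_intros)
    qed (use \<rho> \<rho>01 up far\<gamma> t01 in \<open>auto simp: \<rho>_def\<close>)
    then show ?thesis using \<rho>01 by blast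
  next
    case 2
    then have down: "Y (\<gamma> t) \<le> 0" if "t0 \<le> t" "t \<le> t1" for t
      using t01(4,5) that by (cases "t = t0 \<or> t = t1") auto
    \<comment> \<open>The rotation by \<open>\<pi>\<close> changes the signs of both coordinates; the arch is then run through backwards.\<close>
    define \<rho> where "\<rho> u = t1 - u * (t1 - t0)" for u
    have \<rho>: "t0 \<le> \<rho> u" "\<rho> u \<le> t1" if "u \<in> {0..1}" for u
      using that t01(2) mult_left_le_one_le[of "t1 - t0" u] by (auto simp: \<rho>_def)
    have \<rho>01: "\<rho> u \<in> {0..1}" if "u \<in> {0..1}" for u using \<rho>[OF that] t01(1,3) by auto
    have "\<exists>w\<in>lattice. w \<noteq> 0 \<and> (\<exists>t\<in>{0..1}. \<exists>u\<in>{0..1}. \<gamma> (\<rho> t) = \<gamma> (\<rho> u) + w)"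
    proof (rule arch_meets_lattice_translate)
      show "- X z = (- c) * (fst z - fst p) + (- s) * (snd z - snd p)" for z
        unfolding X_def by algebra
      show "- Y z = (- c) * (snd z - snd p) - (- s) * (fst z - fst p)" for z
        unfolding Y_def by algebra
      show "continuous_on {0..1} (\<lambda>t. \<gamma> (\<rho> t))"
        by (rule continuous_on_compose2[OF cont\<gamma>[of UNIV]]) (auto simp: \<rho>_def intro!: continuous_intros)
    qed (use \<rho> \<rho>01 down far\<gamma> t01 cs in \<open>auto simp: \<rho>_def\<close>)
    then show ?thesis using \<rho>01 by blast
  qed
  then show False using disjoint by (elim bexE conjE) metis
qed

text \<open>
  The points of a convex hull are reached by successive segments, and each of these costs distance 2.
\<close>

lemma hull_near_image:
  assumes \<Phi>: "equivariant \<Phi>" "continuous_on UNIV \<Phi>" "inj \<Phi>"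
    and S: "finite S" and near: "\<And>s. s \<in> S \<Longrightarrow> \<exists>d\<in>{0..<1} \<times> {0..<1}. dist (\<Phi> d) s \<le> r"
    and x: "x \<in> convex hull S"
  shows "\<exists>d\<in>{0..<1} \<times> {0..<1}. dist (\<Phi> d) x \<le> r + 2 * real (card S)"
  using S near x
proof (induction S arbitrary: x)
  case (insert a S)
  show ?case
  proof (cases "S = {}")
    case True
    then have "x = a" using insert.prems(2) by simp
    moreover obtain d where "d \<in> {0..<1} \<times> {0..<1}" "dist (\<Phi> d) a \<le> r"
      using insert.prems(1)[OF insertI1] by (elim bexE)
    ultimately show ?thesis using True by (intro bexI[of _ d]) simp_all
  next
    case False
    then obtain y where y: "y \<in> convex hull S" "x \<in> closed_segment a y"
      using insert.prems(2) unfolding convex_hull_insert_segments by auto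
    let ?R = "r + 2 * real (card S)"
    have "\<exists>d\<in>{0..<1} \<times> {0..<1}. dist (\<Phi> d) y \<le> ?R"
      by (rule insert.IH[OF _ y(1)]) (use insert.prems(1) in blast)
    then obtain d where d: "d \<in> {0..<1} \<times> {0..<1}" "dist (\<Phi> d) y \<le> ?R" by (elim bexE)
    obtain e where e: "e \<in> {0..<1} \<times> {0..<1}" "dist (\<Phi> e) a \<le> r"
      using insert.prems(1)[OF insertI1] by (elim bexE)
    then have e2: "dist (\<Phi> e) a \<le> ?R" by simp
    from y(2) obtain u where u: "0 \<le> u" "u \<le> 1" "x = (1 - u) *\<^sub>R a + u *\<^sub>R y"
      unfolding in_segment by blast
    define x' where "x' = (1 - u) *\<^sub>R \<Phi> e + u *\<^sub>R \<Phi> d"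
    have "x' \<in> closed_segment (\<Phi> e) (\<Phi> d)" unfolding x'_def in_segment using u by blast
    from segment_near_image[OF \<Phi> e(1) d(1) this] obtain f where
      f: "f \<in> {0..<1} \<times> {0..<1}" "dist (\<Phi> f) x' < 2" by (elim bexE)
    have "x' - x = (1 - u) *\<^sub>R (\<Phi> e - a) + u *\<^sub>R (\<Phi> d - y)"
      unfolding x'_def u(3) by (simp add: algebra_simps)
    then have "norm (x' - x) \<le> (1 - u) * norm (\<Phi> e - a) + u * norm (\<Phi> d - y)"
      using u(1,2) by (metis abs_of_nonneg diff_ge_0_iff_ge norm_scaleR norm_triangle_ineq)
    also have "\<dots> \<le> ?R" using u(1,2) e2 d(2) by (intro convex_bound_le) (auto simp: dist_norm)
    finally have "dist x' x \<le> ?R" by (simp add: dist_norm)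
    then have "dist (\<Phi> f) x \<le> ?R + 2" using f(2) dist_triangle[of "\<Phi> f" x x'] by linarith
    then show ?thesis using f(1) insert.hyps by (intro bexI[of _ f]) simp_all
  qed
qed simp

lemma funpow_fixed_translate:
  assumes "equivariant G" "w \<in> lattice" "(G ^^ m) z = z + w"
  shows "(G ^^ (m * k)) z = z + real k *\<^sub>R w"
proof (induction k)
  case (Suc k)
  have "(G ^^ (m * Suc k)) z = (G ^^ m) ((G ^^ (m * k)) z)"
    by (simp add: funpow_add)
  also have "\<dots> = (G ^^ m) z + real k *\<^sub>R w"
    unfolding Suc.IH by (rule equivariantD[OF equivariant_funpow[OF assms(1)] lattice_scaleR_nat[OF assms(2)]])
  finally show ?case using assms(3) by (simp add: algebra_simps)
qed simp

section \<open>Enlarging the rotation set\<close>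

lemma continuous_on_funpow:
  fixes G :: "'a::topological_space \<Rightarrow> 'a"
  assumes "continuous_on UNIV G" shows "continuous_on UNIV (G ^^ n)"
proof (induction n)
  case (Suc n)
  have "continuous_on UNIV (\<lambda>x. G ((G ^^ n) x))" by (rule continuous_on_compose2[OF assms Suc]) simp
  then show ?case by (simp add: comp_def)
qed (simp add: id_def)

text \<open>
  Let \<open>N\<close> be a common period. After \<open>N k\<close> iterations the periodic orbits have moved by exactly \<open>N k s\<close>, so
  the hull of the points \<open>N k s\<close> is near the image of the unit square under that iterate, with an
  error independent of \<open>k\<close>.
\<close>

lemma periodic_vectors_hull_subset_rotation_set:
  assumes G: "equivariant G" "continuous_on UNIV G" "inj G" and S: "finite S"
    and per: "\<And>s. s \<in> S \<Longrightarrow> \<exists>m w z. m \<ge> 1 \<and> w \<in> lattice \<and> s = (1 / real m) *\<^sub>R w \<and> (G ^^ m) z = z + w"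
  shows "convex hull S \<subseteq> rotation_set G"
proof
  fix p assume p: "p \<in> convex hull S"
  obtain m w z where m: "\<And>s. s \<in> S \<Longrightarrow> m s \<ge> 1" "\<And>s. s \<in> S \<Longrightarrow> w s \<in> lattice"
    "\<And>s. s \<in> S \<Longrightarrow> s = (1 / real (m s)) *\<^sub>R w s" "\<And>s. s \<in> S \<Longrightarrow> (G ^^ m s) (z s) = z s + w s"
    using per by metis
  define N where "N = prod m S"
  have N: "N \<ge> 1" unfolding N_def using m(1) S by (metis One_nat_def Suc_leI less_le_trans zero_less_one prod_pos)
  define C where "C = 2 + 2 * real (card S)"
  have unit: "norm d \<le> 2" if "d \<in> {0..<1} \<times> {0..<1}" for d :: plane
    using that norm_Pair_le[of "fst d" "snd d"] by (simp add: mem_Times_iff)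
  have near: "\<exists>d\<in>{0..<1} \<times> {0..<1}. dist ((G ^^ (N * k)) d) (real (N * k) *\<^sub>R p) \<le> C" for k
  proof -
    let ?S = "(*\<^sub>R) (real (N * k)) ` S"
    have "\<exists>d\<in>{0..<1} \<times> {0..<1}. dist ((G ^^ (N * k)) d) (real (N * k) *\<^sub>R p) \<le> 2 + 2 * real (card ?S)"
    proof (rule hull_near_image[OF equivariant_funpow[OF G(1)] continuous_on_funpow[OF G(2)] inj_fn[OF G(3)]])
      show "finite ?S" using S by simp
      show "real (N * k) *\<^sub>R p \<in> convex hull ?S" unfolding convex_hull_scaling using p by (rule imageI)
      fix x assume "x \<in> ?S"
      then obtain s where s: "s \<in> S" "x = real (N * k) *\<^sub>R s" by (elim imageE)
      obtain v where v: "v \<in> lattice" "z s + v \<in> {0..<1} \<times> {0..<1}" by (rule obtain_lattice_translate)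
      let ?d = "z s + v"
      have "(G ^^ m s) ?d = ?d + w s"
        using equivariantD[OF equivariant_funpow[OF G(1)] v(1)] m(4)[OF s(1)] by simp
      note it = funpow_fixed_translate[OF G(1) m(2)[OF s(1)] this]
      have "m s dvd N" unfolding N_def using S s(1) by (rule dvd_prodI)
      then obtain q where q: "N = m s * q" by (rule dvdE)
      have "real (N * k) *\<^sub>R s = real (q * k) *\<^sub>R w s"
        using m(1)[OF s(1)] by (subst m(3)[OF s(1)]) (simp add: q)
      then have "(G ^^ (N * k)) ?d = ?d + x" using it[of "q * k"] by (simp add: q s(2) mult.assoc)
      then have "dist ((G ^^ (N * k)) ?d) x \<le> 2" using unit[OF v(2)] by (simp add: dist_norm)
      with v(2) show "\<exists>d\<in>{0..<1} \<times> {0..<1}. dist ((G ^^ (N * k)) d) x \<le> 2" by (intro bexI)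
    qed
    moreover have "card ?S \<le> card S" using S by (rule card_image_le)
    then have "2 + 2 * real (card ?S) \<le> C" by (simp add: C_def)
    ultimately show ?thesis by (elim bexE) (intro bexI, erule order_trans, assumption+)
  qed
  then obtain d where d: "\<And>k. d k \<in> {0..<1} \<times> {0..<1}"
    "\<And>k. dist ((G ^^ (N * k)) (d k)) (real (N * k) *\<^sub>R p) \<le> C" by metis
  define n where "n k = N * Suc k" for k
  have n1: "real (n k) > 0" for k unfolding n_def of_nat_0_less_iff using N by simp
  have "filterlim n at_top sequentially"
  proof (rule filterlim_at_top_mono[OF filterlim_ident])
    show "\<forall>\<^sub>F k in sequentially. k \<le> n k"
    proof (rule always_eventually, rule allI)
      fix k have "1 * k \<le> N * Suc k" using N by (intro mult_le_mono) auto
      then show "k \<le> n k" by (simp add: n_def)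
    qed
  qed
  moreover have "(\<lambda>k. (1 / real (n k)) *\<^sub>R ((G ^^ n k) (d (Suc k)) - d (Suc k)) - p) \<longlonglongrightarrow> 0"
  proof (rule Lim_null_comparison)
    show "(\<lambda>k. (C + 2) * (1 / real (n k))) \<longlonglongrightarrow> 0"
      by (intro tendsto_mult_right_zero filterlim_compose[OF lim_1_over_n])
        (rule \<open>filterlim n at_top sequentially\<close>)
    have "norm ((1 / real (n k)) *\<^sub>R ((G ^^ n k) (d (Suc k)) - d (Suc k)) - p) \<le> (C + 2) * (1 / real (n k))" for k
    proof -
      let ?g = "(G ^^ n k) (d (Suc k))"
      have "norm (?g - d (Suc k) - real (n k) *\<^sub>R p) \<le> norm (?g - real (n k) *\<^sub>R p) + norm (d (Suc k))"
        using norm_triangle_ineq4[of "?g - real (n k) *\<^sub>R p" "d (Suc k)"] by (simp add: algebra_simps)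
      also have "\<dots> \<le> C + 2" using d(2)[of "Suc k"] unit[OF d(1)[of "Suc k"]] by (simp add: n_def dist_norm)
      finally have *: "norm (?g - d (Suc k) - real (n k) *\<^sub>R p) \<le> C + 2" .
      have "(1 / real (n k)) *\<^sub>R (?g - d (Suc k)) - p = (1 / real (n k)) *\<^sub>R (?g - d (Suc k) - real (n k) *\<^sub>R p)"
        using n1[of k] by (simp add: scaleR_right_diff_distrib)
      then have "norm ((1 / real (n k)) *\<^sub>R (?g - d (Suc k)) - p) = norm (?g - d (Suc k) - real (n k) *\<^sub>R p) * (1 / real (n k))"
        by simp
      also have "\<dots> \<le> (C + 2) * (1 / real (n k))" using * by (intro mult_right_mono) auto
      finally show ?thesis .
    qed
    then show "\<forall>\<^sub>F k in sequentially. norm ((1 / real (n k)) *\<^sub>R ((G ^^ n k) (d (Suc k)) - d (Suc k)) - p) \<le> (C + 2) * (1 / real (n k))"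
      by (intro always_eventually allI)
  qed
  then have "(\<lambda>k. (1 / real (n k)) *\<^sub>R ((G ^^ n k) (d (Suc k)) - d (Suc k))) \<longlonglongrightarrow> p"
    by (simp only: LIM_zero_iff)
  ultimately show "p \<in> rotation_set G" unfolding rotation_set_def
    by (intro CollectI exI[of _ n] exI[of _ "\<lambda>k. d (Suc k)"] conjI)
qed

theorem theorem1p1:
  fixes f :: "torus \<Rightarrow> torus" and F :: "real \<times> real \<Rightarrow> real \<times> real"
    and \<alpha> \<beta> \<epsilon> :: real
  assumes "torus_homeomorphism f" and "homotopic_to_id f" and "non_wandering f"
    and "is_lift F f"
    and "totally_irrational (\<alpha>, \<beta>)"
    and "rotation_set F = closed_segment (0, 0) (\<alpha>, \<beta>)"
    and "\<epsilon> > 0"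
  shows "\<exists>g G. torus_homeomorphism g \<and> homotopic_to_id g \<and> is_lift G g
           \<and> dist_C0 G F < ereal \<epsilon>
           \<and> interior (rotation_set G) \<noteq> {}
           \<and> rotation_set F - {(0, 0)} \<subseteq> interior (rotation_set G)"
proof -
  have F: "equivariant F" "continuous_on UNIV F" "inj F"
  proof -
    show e: "equivariant F" using assms(2,4) by (rule equivariant_lift_of_homotopic_to_id)
    show "continuous_on UNIV F" using assms(4) by (simp add: is_lift_def)
    show "inj F" using assms(1,4) e by (rule inj_lift_of_torus_homeomorphism)
  qed
  \<comment> \<open>The perturbation moves points by at most six times the error of the pseudo-loops, here \<open>\<epsilon> / 2\<close>.\<close>
  have \<delta>: "\<epsilon> / 12 > 0" using assms(7) by simp
  obtain M where M: "rotation_set F \<subseteq> convex hull (loop_vectors F (\<epsilon> / 12) M)" "finite (loop_vectors F (\<epsilon> / 12) M)"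
    using rotation_set_subset_hull_loop_vectors[OF F(1,2) \<delta>] by metis
  define T where "T = loop_vectors F (\<epsilon> / 12) M"
  have "\<forall>t\<in>T. \<exists>m w c. pseudo_loop F (\<epsilon> / 12) m w c \<and> t = (1 / real m) *\<^sub>R w"
    unfolding T_def loop_vectors_def by blast
  then obtain m w c where loop: "\<And>t. t \<in> T \<Longrightarrow> pseudo_loop F (\<epsilon> / 12) (m t) (w t) (c t)"
    "\<And>t. t \<in> T \<Longrightarrow> t = (1 / real (m t)) *\<^sub>R w t" by metis
  have "finite T" unfolding T_def by (rule M(2))
  show ?thesis
  proof (rule realise_pseudo_loops[OF F \<delta> \<open>finite T\<close> loop(1)])
    fix H K assume HK: "equivariant H" "continuous_on UNIV H" "equivariant K" "continuous_on UNIV K"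
      "\<And>z. K (H z) = z" "\<And>z. H (K z) = z" "\<And>z. dist (H z) z \<le> 6 * (\<epsilon> / 12)"
      "\<And>t. t \<in> T \<Longrightarrow> \<exists>z. ((H \<circ> F) ^^ m t) z = z + w t"
    let ?G = "H \<circ> F" and ?g = "descend H \<circ> f"
    have G: "equivariant ?G" using HK(1) F(1) by (rule equivariant_compose)
    have Gc: "continuous_on UNIV ?G" unfolding comp_def by (rule continuous_on_compose2[OF HK(2) F(2)]) simp
    have "inj H" using HK(5) by (metis injI)
    then have Gi: "inj ?G" using F(3) by (rule inj_compose)
    have lift: "is_lift ?G ?g"
      using assms(4) Gc descend_proj[OF HK(1)] unfolding is_lift_def fun_eq_iff comp_def by metis
    have "convex hull T \<subseteq> rotation_set ?G"
    proof (rule periodic_vectors_hull_subset_rotation_set[OF G Gc Gi \<open>finite T\<close>])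
      fix t assume t: "t \<in> T"
      obtain z where "(?G ^^ m t) z = z + w t" using HK(8)[OF t] by (elim exE)
      then show "\<exists>m w z. 1 \<le> m \<and> w \<in> lattice \<and> t = (1 / real m) *\<^sub>R w \<and> (?G ^^ m) z = z + w"
        using loop[OF t] unfolding pseudo_loop_def by (intro exI[of _ "m t"] exI[of _ "w t"] exI[of _ z] conjI) simp_all
    qed
    then have int: "interior (convex hull T) \<subseteq> interior (rotation_set ?G)" by (rule interior_mono)
    have sub: "closed_segment (0, 0) (\<alpha>, \<beta>) \<subseteq> convex hull T" using M(1) assms(6) by (simp add: T_def)
    have v: "(\<alpha>, \<beta>) \<in> interior (convex hull T)"
      using assms(5) \<open>finite T\<close> loop_vectors_rational[of F "\<epsilon> / 12" M, folded T_def]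
      by (rule totally_irrational_in_interior) (use sub in auto)
    have "(0, 0) \<in> closure (convex hull T)" using sub closure_subset by auto
    then have "open_segment (\<alpha>, \<beta>) (0, 0) \<subseteq> interior (convex hull T)"
      using in_interior_closure_convex_segment[OF convex_convex_hull v] by simp
    then have seg: "rotation_set F - {(0, 0)} \<subseteq> interior (convex hull T)"
      using v unfolding assms(6) by (auto simp: open_segment_def closed_segment_commute)
    have "dist_C0 ?G F \<le> ereal (\<epsilon> / 2)"
      unfolding dist_C0_def using HK(7) by (intro SUP_least) simp
    also have "\<dots> < ereal \<epsilon>" using assms(7) by simp
    finally have "dist_C0 ?G F < ereal \<epsilon>" .
    moreover have "torus_homeomorphism ?g"
      by (rule torus_homeomorphism_compose[OF assms(1) torus_homeomorphism_descend[OF HK(1-6)]])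
    moreover have "homotopic_to_id ?g" using G lift by (rule homotopic_to_id_of_equivariant_lift)
    ultimately show ?thesis using lift int v seg
      by (intro exI[of _ ?g] exI[of _ ?G]) auto
  qed
qed

end
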